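(* The Poincaré series for the $m$-quasiinvariants of the dihedral group $I_2(N)$ with constant multiplicity $m\in\mathbb Z_{\ge0}$ is $$p(Q_m,t)=\frac{1+2t^{mN+1}+\cdots+2t^{mN+N-1}+t^{(2m+1)N}}{(1-t^2)(1-t^N)}.$$
   Context: $I_2(N)$, $N\ge2$, is the dihedral group of order $2N$ acting on the Euclidean plane with coordinates $(x_1,x_2)$, generated by the reflections in the lines $(\alpha^j,x)=0$, $\alpha^j=(-\sin\frac{\pi j}{N},\cos\frac{\pi j}{N})$, $j=0,\ldots,N-1$. All multiplicities equal $m\in\mathbb Z_{\ge0}$. $Q_m$ is the ring of $m$-quasiinvariants: polynomials $q(x_1,x_2)$ (complex coefficients) such that for each $\alpha=\alpha^j$ the derivatives $\partial_\alpha^{s}q$, $s=1,3,\ldots,2m-1$, vanish on the line $(\alpha,x)=0$, where $\partial_\alpha=(\alpha,\partial/\partial x)$. The Poincaré series is $p(Q_m,t)=\sum_{d\ge0}\dim (Q_m)_d\,t^d$, where $(Q_m)_d$ is the space of homogeneous quasiinvariants of degree $d$. The numerator is $1+\sum_{j=1}^{N-1}2t^{mN+j}+t^{(2m+1)N}$. *)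

theory Defs
  imports "HOL-Analysis.Analysis" "HOL-Computational_Algebra.Computational_Algebra"
begin

text \<open>
  Polynomials in \<open>x\<^sub>1, x\<^sub>2\<close> over the complex numbers are elements of \<open>complex poly poly\<close>:
  the inner variable is \<open>x\<^sub>1\<close> and the outer one is \<open>x\<^sub>2\<close>, i.e.\ the coefficient of
  \<open>x\<^sub>1\<^sup>i x\<^sub>2\<^sup>j\<close> in \<open>q\<close> is \<open>coeff (coeff q j) i\<close>.
\<close>

type_synonym bipoly = "complex poly poly"

global_interpretation bipoly: vector_space "\<lambda>(c::complex) (q::bipoly). smult [:c:] q"
proof
  fix a b :: complex and p q :: bipoly
  show "smult [:a:] (p + q) = smult [:a:] p + smult [:a:] q"
    by (rule smult_add_right)
  have "smult [:a:] q + smult [:b:] q = smult ([:a:] + [:b:]) q"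
    by (rule smult_add_left[symmetric])
  then show "smult [:a + b:] q = smult [:a:] q + smult [:b:] q"
    by simp
  show "smult [:a:] (smult [:b:] q) = smult [:a * b:] q"
    by (simp add: mult.commute)
  show "smult [:1:] q = q"
    by (simp flip: one_pCons)
qed

definition eval_at :: "bipoly \<Rightarrow> real \<times> real \<Rightarrow> complex" where
  "eval_at q x = poly (poly q [:of_real (snd x):]) (of_real (fst x))"

definition dir_deriv :: "real \<times> real \<Rightarrow> bipoly \<Rightarrow> bipoly" where
  "dir_deriv \<alpha> q =
     smult [:of_real (fst \<alpha>):] (map_poly pderiv q) + smult [:of_real (snd \<alpha>):] (pderiv q)"

definition homogeneous_of_degree :: "nat \<Rightarrow> bipoly \<Rightarrow> bool" where
  "homogeneous_of_degree d q \<longleftrightarrow> (\<forall>i j. coeff (coeff q j) i \<noteq> 0 \<longrightarrow> i + j = d)"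

definition dihedral_root :: "nat \<Rightarrow> nat \<Rightarrow> real \<times> real" where
  "dihedral_root N j = (- sin (pi * real j / real N), cos (pi * real j / real N))"

definition quasiinvariants :: "nat \<Rightarrow> nat \<Rightarrow> bipoly set" where
  "quasiinvariants N m =
     {q. \<forall>j<N. \<forall>s. odd s \<and> s < 2 * m \<longrightarrow>
           (\<forall>x. dihedral_root N j \<bullet> x = 0 \<longrightarrow>
              eval_at ((dir_deriv (dihedral_root N j) ^^ s) q) x = 0)}"

definition poincare_series :: "bipoly set \<Rightarrow> rat fps" where
  "poincare_series V = Abs_fps (\<lambda>d. of_nat (bipoly.dim {q \<in> V. homogeneous_of_degree d q}))"

end

theory Submission
  imports Defs
begin

text \<open>
  In the coordinates \<open>z = x\<^sub>1 + i x\<^sub>2\<close>, \<open>w = x\<^sub>1 - i x\<^sub>2\<close> write a form of degree \<open>d\<close> as the sum of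
  \<open>c\<^sub>k z\<^sup>a w\<^sup>b\<close> over \<open>a + b = d\<close>, \<open>k = a - b\<close>. Restricted to a line through a point of the mirror
  at angle \<open>\<theta>\<close> in normal direction, \<open>z\<^sup>a w\<^sup>b\<close> becomes a multiple of
  \<open>exp (i k \<theta>) (r + i t)\<^sup>a (r - i t)\<^sup>b\<close>, whose coefficient of \<open>t\<^sup>s\<close> is, up to a power of \<open>r\<close>, a
  polynomial in \<open>k\<close> of degree \<open>s\<close> and parity \<open>s\<close>. After a discrete Fourier transform over the \<open>N\<close>
  mirrors, quasiinvariance thus says that, for each residue class \<open>\<rho>\<close> mod \<open>2N\<close> and each odd
  \<open>s < 2m\<close>, the sum of \<open>c\<^sub>k k\<^sup>s\<close> over the \<open>k\<close> in that class vanishes. These conditions do not involve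
  \<open>d\<close>, so multiplication by \<open>z w\<close> identifies the quasiinvariants of degree \<open>d - 2\<close> with those of
  degree \<open>d\<close> for which \<open>c\<^sub>d\<close> and \<open>c\<close> at \<open>- d\<close> are zero. By a Vandermonde argument in the variables \<open>k\<^sup>2\<close>
  the pairs of values at \<open>d\<close>, \<open>- d\<close> form a space of dimension \<open>0\<close> or \<open>2\<close> if \<open>N\<close> does not divide \<open>d\<close>,
  according to whether \<open>d < mN\<close>, and of dimension \<open>1\<close> or \<open>2\<close> if \<open>N\<close> divides \<open>d\<close>, according to whether
  \<open>d < (2m + 1)N\<close>; this is the coefficient of \<open>t\<^sup>d\<close> in \<open>(1 - t\<^sup>2) p(Q\<^sub>m, t)\<close>.
\<close>

section \<open>Bases of spaces of polynomials\<close>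

text \<open>Carries finiteness along with the dimension: \<open>bipoly.dim\<close> is 0 for the zero
  space and for infinite-dimensional spaces alike.\<close>

definition has_basis_of_size :: "bipoly set \<Rightarrow> nat \<Rightarrow> bool" where
  "has_basis_of_size V n \<longleftrightarrow>
     (\<exists>B. finite B \<and> bipoly.independent B \<and> bipoly.span B = V \<and> card B = n)"

lemma has_basis_of_size_imp_dim: "has_basis_of_size V n \<Longrightarrow> bipoly.dim V = n"
  unfolding has_basis_of_size_def using bipoly.dim_span_eq_card_independent by blast

lemma has_basis_of_size_zero: "has_basis_of_size {0} 0"
  unfolding has_basis_of_size_def
  by (intro exI[of _ "{}"]) (simp add: bipoly.independent_empty)

text \<open>The kernel of a nonzero linear functional has codimension one, so a vector outside it
  completes any basis of the kernel.\<close>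

lemma has_basis_of_size_kernel_Suc:
  fixes f :: "bipoly \<Rightarrow> complex"
  assumes U: "has_basis_of_size {v \<in> V. f v = 0} n"
    and V: "bipoly.subspace V" and e: "e \<in> V" "f e \<noteq> 0"
    and add: "\<And>p q. f (p + q) = f p + f q" and scale: "\<And>c q. f (smult [:c:] q) = c * f q"
  shows "has_basis_of_size V (Suc n)"
proof -
  obtain B where B: "finite B" "bipoly.independent B" "bipoly.span B = {v \<in> V. f v = 0}" "card B = n"
    using U unfolding has_basis_of_size_def by blast
  have eB: "e \<notin> bipoly.span B" using e B(3) by auto
  then have eB': "e \<notin> B" using bipoly.span_base by blast
  have iff: "v - smult [:k:] e \<in> V \<longleftrightarrow> v \<in> V" for v k
  proof
    assume "v - smult [:k:] e \<in> V"
    then have "(v - smult [:k:] e) + smult [:k:] e \<in> V"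
      using V e(1) bipoly.subspace_add bipoly.subspace_scale by blast
    then show "v \<in> V" by simp
  next
    assume "v \<in> V"
    then show "v - smult [:k:] e \<in> V"
      using V e(1) bipoly.subspace_diff bipoly.subspace_scale by blast
  qed
  have f: "f (v - smult [:k:] e) = f v - k * f e" for v k
  proof -
    have "f ((v - smult [:k:] e) + smult [:k:] e) = f (v - smult [:k:] e) + k * f e"
      by (simp only: add scale)
    then show ?thesis by simp
  qed
  \<comment> \<open>\<open>bipoly.span_insert\<close> asks for a multiple of \<open>e\<close> whose
    removal from \<open>v\<close> lands in the kernel of \<open>f\<close>.\<close>
  have "\<exists>k. f v = k * f e" for v
    using e(2) by (intro exI[of _ "f v / f e"]) simp
  then have "bipoly.span (insert e B) = V"
    unfolding bipoly.span_insert B(3) using iff f by auto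
  moreover have "bipoly.independent (insert e B)"
    using B(2) eB by (simp add: bipoly.independent_insertI)
  moreover have "card (insert e B) = Suc n" using B eB' by simp
  ultimately show ?thesis
    unfolding has_basis_of_size_def using B(1) by blast
qed

text \<open>Multiplication by \<open>g\<close> is linear, and injective because polynomials form an
  integral domain.\<close>

lemma has_basis_of_size_mult:
  assumes "has_basis_of_size V n" "g \<noteq> 0"
  shows "has_basis_of_size ((*) g ` V) n"
proof -
  interpret vp: vector_space_pair "\<lambda>(c::complex) (q::bipoly). smult [:c:] q" "\<lambda>(c::complex) (q::bipoly). smult [:c:] q"
    by unfold_locales
  have lin: "Vector_Spaces.linear (\<lambda>(c::complex) (q::bipoly). smult [:c:] q) (\<lambda>(c::complex) (q::bipoly). smult [:c:] q) ((*) g)"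
    unfolding Vector_Spaces.linear_iff
    by (simp add: distrib_left) (unfold_locales)
  obtain B where B: "finite B" "bipoly.independent B" "bipoly.span B = V" "card B = n"
    using assms(1) unfolding has_basis_of_size_def by blast
  have inj: "inj ((*) g)" using assms(2) by (auto intro: injI)
  have "bipoly.independent ((*) g ` B)"
    by (rule vp.linear_independent_injective_image[OF lin B(2)])
       (rule inj_on_subset[OF inj subset_UNIV])
  moreover have "bipoly.span ((*) g ` B) = (*) g ` V"
    using vp.linear_span_image[OF lin, of B] B(3) by simp
  moreover have "card ((*) g ` B) = n"
    using card_image[of "(*) g" B] inj B(4) by (metis inj_on_subset subset_UNIV)
  ultimately show ?thesis
    unfolding has_basis_of_size_def using B(1) by blast
qed

section \<open>Restriction to lines\<close>

text \<open>This is q(A(t), B(t)) as a polynomial in t: linear \<open>A\<close>, \<open>B\<close>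
  restrict to a line, constant ones evaluate at a complex point.\<close>

definition subst2 :: "complex poly \<Rightarrow> complex poly \<Rightarrow> bipoly \<Rightarrow> complex poly" where
  "subst2 A B q = poly (map_poly (\<lambda>p. pcompose p A) q) B"

lemma subst2_0 [simp]: "subst2 A B 0 = 0"
  by (simp add: subst2_def)

lemma subst2_pCons [simp]: "subst2 A B (pCons p q) = pcompose p A + B * subst2 A B q"
  by (simp add: subst2_def map_poly_pCons)

lemma subst2_add [simp]: "subst2 A B (p + q) = subst2 A B p + subst2 A B q"
  by (induction p q rule: poly_induct2) (simp_all add: pcompose_add algebra_simps)

lemma subst2_smult [simp]: "subst2 A B (smult c q) = pcompose c A * subst2 A B q"
  by (induction q) (simp_all add: pcompose_mult algebra_simps)

lemma subst2_mult [simp]: "subst2 A B (p * q) = subst2 A B p * subst2 A B q"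
  by (induction p) (simp_all add: algebra_simps)

lemma subst2_1 [simp]: "subst2 A B 1 = 1"
  by (simp add: subst2_def pcompose_1)

lemma subst2_power [simp]: "subst2 A B (p ^ n) = subst2 A B p ^ n"
  by (induction n) simp_all

lemma subst2_sum: "subst2 A B (sum f X) = (\<Sum>x\<in>X. subst2 A B (f x))"
  by (induction X rule: infinite_finite_induct) simp_all

text \<open>The chain rule along the line (a, b) + t \<alpha>.\<close>

lemma subst2_dir_deriv:
  "subst2 [:a, of_real (fst \<alpha>):] [:b, of_real (snd \<alpha>):] (dir_deriv \<alpha> q) =
     pderiv (subst2 [:a, of_real (fst \<alpha>):] [:b, of_real (snd \<alpha>):] q)"
proof (induction q)
  case 0
  then show ?case by (simp add: dir_deriv_def)
next
  case (pCons p q)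
  have "dir_deriv \<alpha> (pCons p q) =
      [:smult (of_real (fst \<alpha>)) (pderiv p):] + smult [:of_real (snd \<alpha>):] q + pCons 0 (dir_deriv \<alpha> q)"
    unfolding dir_deriv_def
    by (simp add: map_poly_pCons pderiv_pCons smult_add_right)
  then show ?case
    using pCons.IH
    by (simp add: pcompose_smult pderiv_add pderiv_mult pderiv_smult pderiv_pcompose pderiv_pCons algebra_simps)
qed

text \<open>Taylor's formula along x + t \<alpha>: iterated directional derivatives become iterated
  derivatives in t, read off at t = 0.\<close>

lemma eval_at_higher_dir_deriv:
  "eval_at ((dir_deriv \<alpha> ^^ s) q) x =
     fact s * coeff (subst2 [:of_real (fst x), of_real (fst \<alpha>):] [:of_real (snd x), of_real (snd \<alpha>):] q) s"
proof -
  let ?L = "subst2 [:of_real (fst x), of_real (fst \<alpha>):] [:of_real (snd x), of_real (snd \<alpha>):]"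
  have eval: "eval_at q x = poly (?L q) 0" for q
    by (induction q) (simp_all add: eval_at_def poly_pcompose)
  have "?L ((dir_deriv \<alpha> ^^ s) q) = (pderiv ^^ s) (?L q)"
    by (induction s) (simp_all add: subst2_dir_deriv)
  then show ?thesis
    by (simp add: eval poly_0_coeff_0 coeff_higher_pderiv pochhammer_fact)
qed

section \<open>Taylor coefficients in the normal direction\<close>

text \<open>As a polynomial in k = a - b this is the coefficient of t^s in (1 + it)^a (1 - it)^b
  with a + b = d. The difference \<open>of_nat d - of_nat s\<close> is taken in the complex numbers,
  so it is not truncated.\<close>

fun angular_poly :: "nat \<Rightarrow> nat \<Rightarrow> complex poly" where
  "angular_poly d 0 = 1"
| "angular_poly d (Suc 0) = [:0, \<i>:]"
| "angular_poly d (Suc (Suc s)) =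
     smult (1 / of_nat (s + 2))
       ([:0, \<i>:] * angular_poly d (Suc s) + smult (of_nat d - of_nat s) (angular_poly d s))"

text \<open>In the recursion one term gains a factor of degree one and the other skips two indices,
  so degree at most s and the parity of s persist.\<close>

lemma coeff_angular_poly_eq_0: "s < n \<or> odd (s + n) \<Longrightarrow> coeff (angular_poly d s) n = 0"
proof (induction d s arbitrary: n rule: angular_poly.induct)
  case (1 d)
  then show ?case by (cases n) auto
next
  case (2 d)
  then show ?case by (cases n) (auto simp: coeff_pCons split: nat.splits, presburger)
next
  case (3 d s)
  have "coeff (angular_poly d s) n = 0"
    using 3(3) by (intro 3(2)) auto
  moreover have "coeff (angular_poly d (Suc s)) l = 0" if "n = Suc l" for l
    using 3(3) that by (intro 3(1)) auto
  ultimately show ?case by (cases n) simp_all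
qed

text \<open>The coefficient is i^s / s!, since only the first summand of the recursion reaches the
  top degree.\<close>

lemma lead_coeff_angular_poly: "coeff (angular_poly d s) s \<noteq> 0"
proof (induction d s rule: angular_poly.induct)
  case (3 d s)
  have "of_nat (s + 2) \<noteq> (0::complex)" unfolding of_nat_eq_0_iff by simp
  with 3 show ?case by (simp add: coeff_angular_poly_eq_0)
qed auto

text \<open>With \<open>G = (1 + it)\<^sup>a (1 - it)\<^sup>b\<close> and \<open>k = a - b\<close>, the recursion of \<open>angular_poly\<close> is
  the differential equation \<open>(1 + t\<^sup>2) G' = (ik + (a + b) t) G\<close>.\<close>

lemma coeff_linear_powers:
  "coeff ([:1, \<i>:] ^ a * [:1, - \<i>:] ^ b) s =
     poly (angular_poly (a + b) s) (of_int (int a - int b))"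
proof -
  define G where "G = [:1, \<i>:] ^ a * [:1, - \<i>:] ^ b"
  have pow: "[:1, u:] * pderiv ([:1, u:] ^ n) = smult (of_nat n * u) ([:1, u:] ^ n)" for u :: complex and n
  proof -
    have "p * pderiv (p ^ n) = smult (of_nat n * u) (p ^ n)" if "pderiv p = [:u:]" for p :: "complex poly"
      using that by (cases n) (simp_all only: pderiv_power_Suc, simp_all add: mult.commute)
    from this[of "[:1, u:]"] show ?thesis by (simp only: pderiv_pCons) simp
  qed
  have factor: "[:1, 0, 1:] = [:1, \<i>:] * [:1, - \<i>:]" by simp
  have "[:1, 0, 1:] * pderiv G =
      ([:1, - \<i>:] * ([:1, \<i>:] * pderiv ([:1, \<i>:] ^ a))) * [:1, - \<i>:] ^ b +
      ([:1, \<i>:] * ([:1, - \<i>:] * pderiv ([:1, - \<i>:] ^ b))) * [:1, \<i>:] ^ a"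
    unfolding factor G_def pderiv_mult by (simp only: algebra_simps)
  also have "\<dots> = (smult (of_nat a * \<i>) [:1, - \<i>:] + smult (of_nat b * - \<i>) [:1, \<i>:]) * G"
    unfolding pow G_def by (simp only: algebra_simps smult_add_left mult_smult_left mult_smult_right)
  also have "smult (of_nat a * \<i>) [:1, - \<i>:] + smult (of_nat b * - \<i>) [:1, \<i>:] =
      [:\<i> * of_int (int a - int b), of_nat (a + b):]"
    by (simp add: algebra_simps)
  finally have ode: "[:1, 0, 1:] * pderiv G = [:\<i> * of_int (int a - int b), of_nat (a + b):] * G" .
  define k where "k = (of_int (int a - int b) :: complex)"
  have c0: "coeff G 0 = 1"
    by (simp add: G_def coeff_mult_0 coeff_0_power)
  have c1: "coeff G 1 = \<i> * k"
    using arg_cong[OF ode, of "\<lambda>p. coeff p 0"] c0 by (simp add: coeff_pderiv k_def)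
  have rec: "of_nat (s + 2) * coeff G (Suc (Suc s)) =
      \<i> * k * coeff G (Suc s) + (of_nat (a + b) - of_nat s) * coeff G s" for s
    using arg_cong[OF ode, of "\<lambda>p. coeff p (Suc s)"]
    by (cases s) (simp_all add: coeff_pderiv k_def algebra_simps)
  have "coeff G s = poly (angular_poly (a + b) s) k"
  proof (induction "a + b" s rule: angular_poly.induct)
    case (3 s)
    have "of_nat (s + 2) \<noteq> (0::complex)" unfolding of_nat_eq_0_iff by simp
    then have "coeff G (Suc (Suc s)) = (of_nat (s + 2) * coeff G (Suc (Suc s))) / of_nat (s + 2)"
      by (simp del: of_nat_add)
    then show ?case unfolding rec using 3 by simp
  qed (use c0 c1 in \<open>auto simp: mult.commute\<close>)
  then show ?thesis by (simp add: G_def k_def)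
qed

text \<open>Homogeneity in r and t reduces this to r = 1. Comparing coefficients instead of
  substituting t/r covers r = 0 as well.\<close>

lemma coeff_linear_powers_scaled:
  fixes r :: complex
  shows "coeff ([:r, \<i>:] ^ a * [:r, - \<i>:] ^ b) s =
     r ^ (a + b - s) * poly (angular_poly (a + b) s) (of_int (int a - int b))"
proof -
  \<comment> \<open>The second conjunct deals with the truncated exponent \<open>n - s\<close>: for
    s > n it is 0, and the coefficient has to vanish instead.\<close>
  define scaled where "scaled n p q \<longleftrightarrow>
     (\<forall>s. coeff p s = r ^ (n - s) * coeff q s \<and> (s > n \<longrightarrow> coeff q s = 0))" for n and p q :: "complex poly"
  have step: "scaled (Suc n) ([:r, u:] * p) ([:1, u:] * q)" if "scaled n p q" for n p q u
    unfolding scaled_def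
  proof (intro allI conjI impI)
    fix s
    show "coeff ([:r, u:] * p) s = r ^ (Suc n - s) * coeff ([:1, u:] * q) s"
    proof (cases s)
      case (Suc k)
      show ?thesis
      proof (cases "Suc k \<le> n")
        case True
        then have "n - k = Suc (n - Suc k)" by simp
        then show ?thesis using that Suc unfolding scaled_def by (simp add: algebra_simps)
      next
        case False
        then show ?thesis using that Suc unfolding scaled_def by (simp add: algebra_simps)
      qed
    qed (use that in \<open>simp add: scaled_def\<close>)
    show "coeff ([:1, u:] * q) s = 0" if "Suc n < s"
      using that \<open>scaled n p q\<close> unfolding scaled_def by (cases s) auto
  qed
  have "scaled 0 1 1" by (auto simp: scaled_def)
  then have "scaled b ([:r, - \<i>:] ^ b) ([:1, - \<i>:] ^ b)"
    by (induction b) (simp_all only: power_Suc power_0 step)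
  then have "scaled (a + b) ([:r, \<i>:] ^ a * [:r, - \<i>:] ^ b) ([:1, \<i>:] ^ a * [:1, - \<i>:] ^ b)"
    by (induction a) (simp_all only: power_Suc power_0 mult.assoc add_Suc add_0 mult_1 step)
  then show ?thesis
    by (simp add: scaled_def coeff_linear_powers)
qed

text \<open>The angular moment of odd order s is a combination of odd power moments up to order s,
  with nonzero coefficient at s; induction on s inverts this triangular system.\<close>

lemma angular_moments_iff_power_moments:
  fixes w k :: "'a \<Rightarrow> complex"
  shows "(\<forall>s. odd s \<and> s < M \<longrightarrow> (\<Sum>a\<in>A. w a * poly (angular_poly d s) (k a)) = 0) \<longleftrightarrow>
    (\<forall>s. odd s \<and> s < M \<longrightarrow> (\<Sum>a\<in>A. w a * k a ^ s) = 0)" (is "?L \<longleftrightarrow> ?R")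
proof -
  have exp: "(\<Sum>a\<in>A. w a * poly (angular_poly d s) (k a)) =
     (\<Sum>n\<le>s. coeff (angular_poly d s) n * (\<Sum>a\<in>A. w a * k a ^ n))" for s
  proof -
    have "poly (angular_poly d s) x = (\<Sum>n\<le>s. coeff (angular_poly d s) n * x ^ n)" for x
      unfolding poly_altdef
      by (rule sum.mono_neutral_left)
         (auto intro!: degree_le simp: coeff_angular_poly_eq_0 coeff_eq_0)
    then show ?thesis
      by (simp add: sum_distrib_left mult_ac) (rule sum.swap)
  qed
  show ?thesis
  proof
    assume R: ?R
    show ?L
    proof (intro allI impI)
      fix s assume s: "odd s \<and> s < M"
      have "coeff (angular_poly d s) n * (\<Sum>a\<in>A. w a * k a ^ n) = 0" if "n \<le> s" for n
        using that s R by (cases "odd n") (auto simp: coeff_angular_poly_eq_0)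
      then show "(\<Sum>a\<in>A. w a * poly (angular_poly d s) (k a)) = 0"
        unfolding exp by (intro sum.neutral) auto
    qed
  next
    assume L: ?L
    have "odd s \<Longrightarrow> s < M \<Longrightarrow> (\<Sum>a\<in>A. w a * k a ^ s) = 0" for s
    proof (induction s rule: less_induct)
      case (less s)
      have "coeff (angular_poly d s) n * (\<Sum>a\<in>A. w a * k a ^ n) = 0" if "n < s" for n
        using that less by (cases "odd n") (auto simp: coeff_angular_poly_eq_0)
      then have "(\<Sum>n\<le>s. coeff (angular_poly d s) n * (\<Sum>a\<in>A. w a * k a ^ n)) =
          coeff (angular_poly d s) s * (\<Sum>a\<in>A. w a * k a ^ s)"
        by (subst sum.mono_neutral_right[of _ "{s}"]) auto
      then show ?case
        using L less.prems exp lead_coeff_angular_poly[of d s] by auto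
    qed
    then show ?R by blast
  qed
qed

section \<open>Quasiinvariance as vanishing of moments\<close>

definition z_poly :: bipoly where "z_poly = [:[:0, 1:], [:\<i>:]:]"
definition w_poly :: bipoly where "w_poly = [:[:0, 1:], [:- \<i>:]:]"

text \<open>Coefficients are indexed by the weight \<open>k = a - (d - a)\<close> of the monomial
  \<open>z\<^sup>a w\<^sup>d\<^sup>-\<^sup>a\<close> under rotations, so that the defining conditions do not depend on \<open>d\<close>.\<close>

definition zw_form :: "nat \<Rightarrow> (int \<Rightarrow> complex) \<Rightarrow> bipoly" where
  "zw_form d c = (\<Sum>a\<le>d. smult [:c (2 * int a - int d):] (z_poly ^ a * w_poly ^ (d - a)))"

lemma zw_form_add: "zw_form d c + zw_form d c' = zw_form d (\<lambda>k. c k + c' k)"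
proof -
  have "smult [:x + y:] p = smult [:x:] p + smult [:y:] p" for x y and p :: bipoly
    by (rule bipoly.scale_left_distrib)
  then show ?thesis by (simp only: zw_form_def sum.distrib)
qed

lemma zw_form_smult: "smult [:x:] (zw_form d c) = zw_form d (\<lambda>k. x * c k)"
  unfolding zw_form_def bipoly.scale_sum_right by (simp add: mult.commute)

lemma zw_form_0: "zw_form d (\<lambda>_. 0) = 0"
  by (simp add: zw_form_def)

text \<open>Multiplication by z raises every weight by one. At the new lowest weight,
  \<open>c (k - 1)\<close> would be a value of \<open>c\<close> outside the weights of degree
  \<open>d\<close>, hence the explicit 0.\<close>

lemma z_mult_zw_form:
  "z_poly * zw_form d c = zw_form (Suc d) (\<lambda>k. if k = - int (Suc d) then 0 else c (k - 1))"
proof -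
  have [simp]: "2 * int (Suc a) - int (Suc d) - 1 = 2 * int a - int d"
    "2 * int (Suc a) - int (Suc d) \<noteq> - int (Suc d)" for a
    by auto
  show ?thesis
    unfolding zw_form_def sum.atMost_Suc_shift sum_distrib_left
    by (simp del: of_nat_Suc add: mult.assoc)
qed

text \<open>Multiplication by w lowers every weight by one and leaves the new highest weight
  empty.\<close>

lemma w_mult_zw_form:
  "w_poly * zw_form d c = zw_form (Suc d) (\<lambda>k. if k = int (Suc d) then 0 else c (k + 1))"
proof -
  define F where "F a = smult [:if 2 * int a - int (Suc d) = int (Suc d) then 0
      else c (2 * int a - int (Suc d) + 1):] (z_poly ^ a * w_poly ^ (Suc d - a))" for a
  have "F a = w_poly * smult [:c (2 * int a - int d):] (z_poly ^ a * w_poly ^ (d - a))" if "a \<le> d" for a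
    using that by (simp add: F_def Suc_diff_le mult_ac)
  moreover have "F (Suc d) = 0" by (simp add: F_def)
  ultimately have "(\<Sum>a\<le>Suc d. F a) =
      (\<Sum>a\<le>d. w_poly * smult [:c (2 * int a - int d):] (z_poly ^ a * w_poly ^ (d - a)))"
    by simp
  then show ?thesis
    unfolding zw_form_def F_def sum_distrib_left ..
qed

text \<open>Since x_1 = (z + w)/2 and x_2 = (z - w)/(2i), multiplication by x_1 or x_2 turns a form
  in z, w into one of the next degree, so every monomial is such a form.\<close>

lemma homogeneous_imp_zw_form:
  assumes "homogeneous_of_degree d q"
  shows "\<exists>c. q = zw_form d c"
proof -
  define is_form where "is_form n p \<longleftrightarrow> (\<exists>c. p = zw_form n c)" for n p
  have add: "is_form n (p + p')" if "is_form n p" "is_form n p'" for n p p'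
    using that unfolding is_form_def by (auto simp: zw_form_add)
  have scale: "is_form n (smult [:x:] p)" if "is_form n p" for n x p
    using that unfolding is_form_def by (auto simp: zw_form_smult)
  have zero: "is_form n 0" for n
    unfolding is_form_def using zw_form_0[of n, symmetric] by blast
  have z: "is_form (Suc n) (z_poly * p)" and w: "is_form (Suc n) (w_poly * p)" if "is_form n p" for n p
    using that unfolding is_form_def by (auto simp: z_mult_zw_form w_mult_zw_form)
  have x1: "[:[:0, 1:]:] = smult [:1/2:] z_poly + smult [:1/2:] w_poly"
    and x2: "[:0, 1:] = smult [:- \<i>/2:] z_poly + smult [:\<i>/2:] w_poly"
    by (simp_all add: z_poly_def w_poly_def one_pCons)
  have x1': "is_form (Suc n) ([:[:0, 1:]:] * p)" and x2': "is_form (Suc n) ([:0, 1:] * p)"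
    if "is_form n p" for n p
    unfolding x1 x2 distrib_right mult_smult_left using that by (intro add scale z w; simp)+
  have one: "is_form 0 1"
    unfolding is_form_def by (rule exI[of _ "\<lambda>_. 1"]) (simp add: zw_form_def flip: one_pCons)
  have "is_form j ([:0, 1:] ^ j)" for j
    by (induction j) (simp_all only: power_0 power_Suc one x2')
  then have pow: "is_form (i + j) ([:[:0, 1:]:] ^ i * [:0, 1:] ^ j)" for i j
    by (induction i) (simp_all only: power_0 power_Suc mult_1 add_0 add_Suc mult.assoc x1')
  have mon: "monom (monom x i) j = smult [:x:] ([:[:0, 1:]:] ^ i * [:0, 1:] ^ j)" for x :: complex and i j
  proof -
    have "[:[:0, 1:] :: complex poly:] ^ i = [:[:0, 1:] ^ i:]"
      by (induction i) (simp_all add: one_pCons)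
    then show ?thesis
      by (simp add: monom_altdef)
  qed
  have term_form: "is_form d (monom (monom (coeff (coeff q j) i) i) j)" for i j
  proof (cases "coeff (coeff q j) i = 0")
    case True
    then show ?thesis by (simp add: zero)
  next
    case False
    then have "i + j = d" using assms by (simp add: homogeneous_of_degree_def)
    then show ?thesis unfolding mon using scale pow by blast
  qed
  have sum: "is_form d (sum f A)" if "\<And>x. x \<in> A \<Longrightarrow> is_form d (f x)" for f :: "nat \<Rightarrow> bipoly" and A
    using that
  proof (induction A rule: infinite_finite_induct)
    case (insert x F)
    then show ?case using add[of d "f x" "sum f F"] by simp
  qed (use zero in simp_all)
  have "is_form d (monom (coeff q j) j)" for j
  proof -
    have "monom (coeff q j) j = (\<Sum>i\<le>degree (coeff q j). monom (monom (coeff (coeff q j) i) i) j)"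
      by (simp add: poly_as_sum_of_monoms flip: monom_sum)
    also have "is_form d \<dots>" by (intro sum term_form)
    finally show ?thesis .
  qed
  then have "is_form d (\<Sum>j\<le>degree q. monom (coeff q j) j)" by (intro sum)
  then show ?thesis by (simp add: poly_as_sum_of_monoms is_form_def)
qed

lemma homogeneous_mult:
  assumes "homogeneous_of_degree a p" "homogeneous_of_degree b q"
  shows "homogeneous_of_degree (a + b) (p * q)"
  unfolding homogeneous_of_degree_def
proof (intro allI impI)
  fix i j assume "coeff (coeff (p * q) j) i \<noteq> 0"
  then have "(\<Sum>l\<le>j. \<Sum>k\<le>i. coeff (coeff p l) k * coeff (coeff q (j - l)) (i - k)) \<noteq> 0"
    by (simp add: coeff_mult coeff_sum)
  then obtain l where l: "l \<le> j" "(\<Sum>k\<le>i. coeff (coeff p l) k * coeff (coeff q (j - l)) (i - k)) \<noteq> 0"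
    using sum.not_neutral_contains_not_neutral by (metis (no_types, lifting) atMost_iff)
  then obtain k where k: "k \<le> i" "coeff (coeff p l) k * coeff (coeff q (j - l)) (i - k) \<noteq> 0"
    using sum.not_neutral_contains_not_neutral by (metis (no_types, lifting) atMost_iff)
  then have "k + l = a" "(i - k) + (j - l) = b"
    using assms unfolding homogeneous_of_degree_def by auto
  then show "i + j = a + b" using l k by simp
qed

lemma homogeneous_zw_form: "homogeneous_of_degree d (zw_form d c)"
proof -
  have one: "homogeneous_of_degree 0 1"
    by (auto simp: homogeneous_of_degree_def one_pCons coeff_pCons split: nat.splits)
  have z: "homogeneous_of_degree 1 z_poly" and w: "homogeneous_of_degree 1 w_poly"
    by (auto simp: homogeneous_of_degree_def z_poly_def w_poly_def coeff_pCons split: nat.splits)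
  have pow: "homogeneous_of_degree n (p ^ n)" if "homogeneous_of_degree 1 p" for n p
    using homogeneous_mult[OF that] one by (induction n) auto
  have mon: "homogeneous_of_degree d (z_poly ^ a * w_poly ^ (d - a))" if "a \<le> d" for a
    using homogeneous_mult[OF pow[OF z, of a] pow[OF w, of "d - a"]] that by simp
  show ?thesis
    unfolding homogeneous_of_degree_def
  proof (intro allI impI)
    fix i j assume "coeff (coeff (zw_form d c) j) i \<noteq> 0"
    then have "(\<Sum>a\<le>d. c (2 * int a - int d) * coeff (coeff (z_poly ^ a * w_poly ^ (d - a)) j) i) \<noteq> 0"
      by (simp add: zw_form_def coeff_sum)
    then obtain a where "a \<le> d" "c (2 * int a - int d) * coeff (coeff (z_poly ^ a * w_poly ^ (d - a)) j) i \<noteq> 0"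
      using sum.not_neutral_contains_not_neutral by (metis (no_types, lifting) atMost_iff)
    then show "i + j = d" using mon[of a] unfolding homogeneous_of_degree_def by auto
  qed
qed

text \<open>The values a - b over the monomials z^a w^b with a + b = d.\<close>

definition weights :: "nat \<Rightarrow> int set" where
  "weights d = {k. \<bar>k\<bar> \<le> int d \<and> even (k + int d)}"

lemma finite_weights [simp]: "finite (weights d)"
  by (rule finite_subset[of _ "{- int d..int d}"]) (auto simp: weights_def)

lemma sum_weights: "(\<Sum>a\<le>d. g (2 * int a - int d)) = (\<Sum>k\<in>weights d. g k)"
  by (rule sum.reindex_bij_witness[where i = "\<lambda>k. nat ((k + int d) div 2)" and j = "\<lambda>a. 2 * int a - int d"])
     (auto simp: weights_def)

text \<open>On this line z = exp(i \<theta>) (r + it) and w = exp(-i \<theta>) (r - it), so in z^a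
  w^b the phases combine to exp(i k \<theta>) with k = a - b.\<close>

lemma coeff_zw_form_on_line:
  fixes r \<theta> :: real
  shows "coeff (subst2 [:of_real (r * cos \<theta>), of_real (- sin \<theta>):]
                       [:of_real (r * sin \<theta>), of_real (cos \<theta>):] (zw_form d c)) s =
    of_real r ^ (d - s) *
      (\<Sum>k\<in>weights d. c k * cis (\<theta> * of_int k) * poly (angular_poly d s) (of_int k))"
proof -
  let ?L = "subst2 [:of_real (r * cos \<theta>), of_real (- sin \<theta>):]
                   [:of_real (r * sin \<theta>), of_real (cos \<theta>):]"
  have z: "?L z_poly = smult (cis \<theta>) [:of_real r, \<i>:]"
    and w: "?L w_poly = smult (cis (- \<theta>)) [:of_real r, - \<i>:]"
    by (simp_all add: z_poly_def w_poly_def pcompose_pCons complex_eq_iff cis.code)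
  have mon: "coeff (?L (z_poly ^ a * w_poly ^ (d - a))) s =
      of_real r ^ (d - s) * (cis (\<theta> * of_int (2 * int a - int d)) *
        poly (angular_poly d s) (of_int (2 * int a - int d)))" if "a \<le> d" for a
  proof -
    have "cis \<theta> ^ a * cis (- \<theta>) ^ (d - a) = cis (\<theta> * of_int (2 * int a - int d))"
      unfolding Complex.DeMoivre cis_mult using that by (simp add: of_nat_diff algebra_simps)
    moreover have "int a - int (d - a) = 2 * int a - int d" using that by simp
    ultimately show ?thesis
      using that coeff_linear_powers_scaled[of "of_real r" a "d - a" s]
      unfolding subst2_mult subst2_power z w smult_power
      by (simp add: mult_ac del: of_int_diff of_int_mult of_int_add)
  qed
  have "coeff (?L (zw_form d c)) s =
      (\<Sum>a\<le>d. c (2 * int a - int d) * coeff (?L (z_poly ^ a * w_poly ^ (d - a))) s)"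
    unfolding zw_form_def subst2_sum coeff_sum
    by (intro sum.cong refl) (simp only: subst2_smult pcompose_const, simp)
  also have "\<dots> = (\<Sum>a\<le>d. (\<lambda>k. of_real r ^ (d - s) *
      (c k * cis (\<theta> * of_int k) * poly (angular_poly d s) (of_int k))) (2 * int a - int d))"
  proof (intro sum.cong refl)
    fix a assume "a \<in> {..d}"
    then have "a \<le> d" by simp
    show "c (2 * int a - int d) * coeff (?L (z_poly ^ a * w_poly ^ (d - a))) s =
        (\<lambda>k. of_real r ^ (d - s) * (c k * cis (\<theta> * of_int k) *
          poly (angular_poly d s) (of_int k))) (2 * int a - int d)"
      unfolding mon[OF \<open>a \<le> d\<close>] by (simp only: mult_ac)
  qed
  also have "\<dots> = (\<Sum>k\<in>weights d. of_real r ^ (d - s) *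
      (c k * cis (\<theta> * of_int k) * poly (angular_poly d s) (of_int k)))"
    by (rule sum_weights)
  finally show ?thesis
    unfolding sum_distrib_left .
qed

section \<open>Discrete Fourier transform over the mirrors\<close>

text \<open>For l = 2t the summands are the powers of exp(2 pi i t / N), an N-th root of unity, and
  their geometric sum vanishes unless that root is 1.\<close>

lemma sum_cis_even:
  fixes l :: int
  assumes "N > 0" "even l"
  shows "(\<Sum>j<N. cis (pi * real j * of_int l / real N)) = (if 2 * int N dvd l then of_nat N else 0)"
proof -
  obtain t where t: "l = 2 * t" using assms(2) by blast
  define x where "x = cis (2 * pi * of_int t / real N)"
  have pow: "cis (pi * real j * of_int l / real N) = x ^ j" for j
    unfolding x_def Complex.DeMoivre t by (simp add: field_simps)
  have xN: "x ^ N = 1"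
    using assms(1) cis_multiple_2pi[of "of_int t"] unfolding x_def Complex.DeMoivre by simp
  have "x = 1 \<longleftrightarrow> int N dvd t"
  proof
    assume "x = 1"
    then have "cos (2 * pi * of_int t / real N) = 1" by (simp add: x_def complex_eq_iff)
    then obtain n :: int where "2 * pi * of_int t / real N = of_int n * 2 * pi"
      unfolding cos_one_2pi_int by blast
    then have "real_of_int t = of_int (n * int N)" using assms(1) by (simp add: field_simps)
    then show "int N dvd t" by (simp only: of_int_eq_iff) simp
  next
    assume "int N dvd t"
    then obtain n where "t = int N * n" by blast
    then show "x = 1"
      using assms(1) cis_multiple_2pi[of "of_int n"] by (simp add: x_def field_simps)
  qed
  then show ?thesis
    using geometric_sum[of x N] xN unfolding pow unfolding t by (cases "x = 1") auto
qed

text \<open>The characters have period 2N in k, yet N of them separate the classes, because indices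
  of one parity meet only N residue classes mod 2N.\<close>

lemma fourier_vanishing_iff:
  fixes f :: "int \<Rightarrow> complex"
  assumes "finite K" "N > 0" and par: "\<And>k l. k \<in> K \<Longrightarrow> l \<in> K \<Longrightarrow> even (k - l)"
  shows "(\<forall>j<N. (\<Sum>k\<in>K. f k * cis (pi * real j * of_int k / real N)) = 0) \<longleftrightarrow>
    (\<forall>\<rho>. (\<Sum>k | k \<in> K \<and> 2 * int N dvd k - \<rho>. f k) = 0)"
proof
  assume L: "\<forall>j<N. (\<Sum>k\<in>K. f k * cis (pi * real j * of_int k / real N)) = 0"
  have vanish: "(\<Sum>k | k \<in> K \<and> 2 * int N dvd k - \<rho>. f k) = 0" if \<rho>: "\<rho> \<in> K" for \<rho>
  proof -
    \<comment> \<open>Fourier inversion: multiplying by the conjugate character at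
      \<open>\<rho>\<close> and summing over \<open>j\<close> isolates the class of
      \<open>\<rho>\<close>. Since \<open>\<rho>\<close> is in \<open>K\<close>, all k - \<rho> are
      even.\<close>
    have "0 = (\<Sum>j<N. cis (- (pi * real j * of_int \<rho> / real N)) *
        (\<Sum>k\<in>K. f k * cis (pi * real j * of_int k / real N)))"
      using L by simp
    also have "\<dots> = (\<Sum>j<N. \<Sum>k\<in>K. f k * cis (pi * real j * of_int (k - \<rho>) / real N))"
      unfolding sum_distrib_left
    proof (intro sum.cong refl)
      fix j k
      have "cis (- (pi * real j * of_int \<rho> / real N)) * cis (pi * real j * of_int k / real N) =
          cis (pi * real j * of_int (k - \<rho>) / real N)"
        by (simp add: cis_mult field_simps diff_divide_distrib)
      then show "cis (- (pi * real j * of_int \<rho> / real N)) * (f k * cis (pi * real j * of_int k / real N)) =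
          f k * cis (pi * real j * of_int (k - \<rho>) / real N)"
        by (metis mult.left_commute)
    qed
    also have "\<dots> = (\<Sum>k\<in>K. f k * (\<Sum>j<N. cis (pi * real j * of_int (k - \<rho>) / real N)))"
      unfolding sum_distrib_left by (rule sum.swap)
    also have "\<dots> = (\<Sum>k\<in>K. if 2 * int N dvd k - \<rho> then of_nat N * f k else 0)"
    proof (intro sum.cong refl)
      fix k assume "k \<in> K"
      then have "even (k - \<rho>)" using par \<rho> by blast
      from sum_cis_even[OF assms(2) this]
      show "f k * (\<Sum>j<N. cis (pi * real j * of_int (k - \<rho>) / real N)) =
          (if 2 * int N dvd k - \<rho> then of_nat N * f k else 0)"
        by (simp only:) simp
    qed
    also have "\<dots> = of_nat N * (\<Sum>k | k \<in> K \<and> 2 * int N dvd k - \<rho>. f k)"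
      using assms(1) by (subst sum.inter_filter[symmetric]) (simp_all add: sum_distrib_left)
    finally show ?thesis
      using assms(2) by simp
  qed
  show "\<forall>\<rho>. (\<Sum>k | k \<in> K \<and> 2 * int N dvd k - \<rho>. f k) = 0"
  proof
    fix \<rho>
    show "(\<Sum>k | k \<in> K \<and> 2 * int N dvd k - \<rho>. f k) = 0"
    proof (cases "\<exists>l\<in>K. 2 * int N dvd l - \<rho>")
      case True
      then obtain l where l: "l \<in> K" "2 * int N dvd l - \<rho>" by blast
      have "2 * int N dvd k - \<rho> \<longleftrightarrow> 2 * int N dvd k - l" for k
        using dvd_add_left_iff[OF l(2), of "k - l"] by simp
      then show ?thesis using vanish[OF l(1)] by simp
    next
      case False
      then have "{k. k \<in> K \<and> 2 * int N dvd k - \<rho>} = {}" by blast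
      then show ?thesis by (simp only: sum.empty)
    qed
  qed
next
  assume R: "\<forall>\<rho>. (\<Sum>k | k \<in> K \<and> 2 * int N dvd k - \<rho>. f k) = 0"
  show "\<forall>j<N. (\<Sum>k\<in>K. f k * cis (pi * real j * of_int k / real N)) = 0"
  proof (intro allI impI)
    fix j
    let ?g = "\<lambda>k. f k * cis (pi * real j * of_int k / real N)"
    have per: "cis (pi * real j * of_int k / real N) = cis (pi * real j * of_int \<rho> / real N)"
      if "2 * int N dvd k - \<rho>" for k \<rho>
    proof -
      obtain n where "k - \<rho> = 2 * int N * n" using \<open>2 * int N dvd k - \<rho>\<close> by blast
      then have k: "k = \<rho> + 2 * int N * n" by simp
      have "pi * real j * of_int k / real N = pi * real j * of_int \<rho> / real N + 2 * pi * of_int (int j * n)"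
        using assms(2) by (simp add: k field_simps)
      then show ?thesis by (simp flip: cis_mult)
    qed
    \<comment> \<open>Each character is constant on a residue class mod 2N, so the sum of
      \<open>?g\<close> vanishes class by class.\<close>
    have "(\<Sum>k | k \<in> K \<and> k mod (2 * int N) = y. ?g k) = 0" if "y \<in> (\<lambda>k. k mod (2 * int N)) ` K" for y
    proof -
      obtain \<rho> where \<rho>: "\<rho> \<in> K" "y = \<rho> mod (2 * int N)" using \<open>y \<in> _\<close> by blast
      have "(\<Sum>k | k \<in> K \<and> k mod (2 * int N) = y. ?g k) =
          (\<Sum>k | k \<in> K \<and> 2 * int N dvd k - \<rho>. f k * cis (pi * real j * of_int \<rho> / real N))"
        by (rule sum.cong) (auto simp: \<rho>(2) mod_eq_dvd_iff per)
      then show ?thesis using R by (simp flip: sum_distrib_right)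
    qed
    then have "(\<Sum>y\<in>(\<lambda>k. k mod (2 * int N)) ` K. \<Sum>k | k \<in> K \<and> k mod (2 * int N) = y. ?g k) = 0"
      by (rule sum.neutral[rule_format])
    then show "(\<Sum>k\<in>K. ?g k) = 0"
      using sum.group[of K "(\<lambda>k. k mod (2 * int N)) ` K" "\<lambda>k. k mod (2 * int N)" ?g] assms(1) by simp
  qed
qed

definition moments_vanish :: "nat \<Rightarrow> nat \<Rightarrow> nat \<Rightarrow> (int \<Rightarrow> complex) \<Rightarrow> bool" where
  "moments_vanish N m d c \<longleftrightarrow> (\<forall>s. odd s \<and> s < 2 * m \<longrightarrow>
     (\<forall>\<rho>. (\<Sum>k | k \<in> weights d \<and> 2 * int N dvd k - \<rho>. c k * of_int k ^ s) = 0))"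

text \<open>The mirror is spanned by the unit vector at angle pi j / N, and \<open>r\<close> is the
  inner product of x with that vector.\<close>

lemma line_orthogonal_to_root:
  "dihedral_root N j \<bullet> x = 0 \<longleftrightarrow>
     (\<exists>r. x = (r * cos (pi * real j / real N), r * sin (pi * real j / real N)))"
proof
  let ?\<theta> = "pi * real j / real N"
  assume "dihedral_root N j \<bullet> x = 0"
  then have *: "snd x * cos ?\<theta> = fst x * sin ?\<theta>"
    by (cases x) (simp add: dihedral_root_def mult.commute)
  define r where "r = fst x * cos ?\<theta> + snd x * sin ?\<theta>"
  have "r * cos ?\<theta> = fst x * (cos ?\<theta>)\<^sup>2 + (snd x * cos ?\<theta>) * sin ?\<theta>"
    unfolding r_def by (simp add: algebra_simps power2_eq_square)
  also have "\<dots> = fst x * ((sin ?\<theta>)\<^sup>2 + (cos ?\<theta>)\<^sup>2)"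
    unfolding * by (simp only: algebra_simps power2_eq_square)
  finally have "r * cos ?\<theta> = fst x" by simp
  moreover have "r * sin ?\<theta> = snd x * (sin ?\<theta>)\<^sup>2 + (fst x * sin ?\<theta>) * cos ?\<theta>"
    unfolding r_def by (simp add: algebra_simps power2_eq_square)
  then have "r * sin ?\<theta> = snd x * ((sin ?\<theta>)\<^sup>2 + (cos ?\<theta>)\<^sup>2)"
    unfolding *[symmetric] by (simp only: algebra_simps power2_eq_square)
  then have "r * sin ?\<theta> = snd x" by simp
  ultimately show "\<exists>r. x = (r * cos ?\<theta>, r * sin ?\<theta>)" by (metis prod.collapse)
qed (auto simp: dihedral_root_def)

lemma zw_form_in_quasiinvariants_iff:
  assumes "N > 0"
  shows "zw_form d c \<in> quasiinvariants N m \<longleftrightarrow> moments_vanish N m d c"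
proof -
  let ?\<theta> = "\<lambda>j. pi * real j / real N"
  let ?S = "\<lambda>j s. \<Sum>k\<in>weights d. c k * cis (?\<theta> j * of_int k) * poly (angular_poly d s) (of_int k)"
  have eval: "eval_at ((dir_deriv (dihedral_root N j) ^^ s) (zw_form d c)) (r * cos (?\<theta> j), r * sin (?\<theta> j)) =
      fact s * (of_real r ^ (d - s) * ?S j s)" for j s r
    using coeff_zw_form_on_line[of r "?\<theta> j" d c s]
    by (simp add: eval_at_higher_dir_deriv dihedral_root_def)
  have "zw_form d c \<in> quasiinvariants N m \<longleftrightarrow> (\<forall>j<N. \<forall>s. odd s \<and> s < 2 * m \<longrightarrow>
      (\<forall>r. eval_at ((dir_deriv (dihedral_root N j) ^^ s) (zw_form d c)) (r * cos (?\<theta> j), r * sin (?\<theta> j)) = 0))"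
    unfolding quasiinvariants_def line_orthogonal_to_root by blast
  also have "\<dots> \<longleftrightarrow> (\<forall>j<N. \<forall>s. odd s \<and> s < 2 * m \<longrightarrow>
      (\<forall>r. fact s * (complex_of_real r ^ (d - s) * ?S j s) = 0))"
    by (simp only: eval)
  also have "\<dots> \<longleftrightarrow> (\<forall>j<N. \<forall>s. odd s \<and> s < 2 * m \<longrightarrow> ?S j s = 0)"
  proof -
    have "(\<forall>r. fact s * (complex_of_real r ^ (d - s) * ?S j s) = 0) \<longleftrightarrow> ?S j s = 0" for j s
    proof
      assume "\<forall>r. fact s * (complex_of_real r ^ (d - s) * ?S j s) = 0"
      \<comment> \<open>On the mirror the derivative is a multiple of r^(d - s), so the single point
        r = 1 tests it.\<close>
      from this[rule_format, of 1] show "?S j s = 0" by simp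
    qed simp
    then show ?thesis by simp
  qed
  \<comment> \<open>On each mirror separately, with the phases absorbed into the coefficients,
    \<open>angular_poly\<close> is replaced by powers of k; the Fourier transform over the mirrors
    follows.\<close>
  also have "\<dots> \<longleftrightarrow> (\<forall>j<N. \<forall>s. odd s \<and> s < 2 * m \<longrightarrow>
      (\<Sum>k\<in>weights d. c k * cis (?\<theta> j * of_int k) * of_int k ^ s) = 0)"
    by (simp only: angular_moments_iff_power_moments)
  also have "\<dots> \<longleftrightarrow> (\<forall>s. odd s \<and> s < 2 * m \<longrightarrow>
      (\<forall>j<N. (\<Sum>k\<in>weights d. c k * of_int k ^ s * cis (pi * real j * of_int k / real N)) = 0))"
    by (auto simp: mult_ac)
  also have "\<dots> \<longleftrightarrow> moments_vanish N m d c"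
  proof -
    have "even (k - l)" if "k \<in> weights d" "l \<in> weights d" for k l
      using that by (auto simp: weights_def)
    then show ?thesis
      unfolding moments_vanish_def
      by (simp only: fourier_vanishing_iff[OF finite_weights assms])
  qed
  finally show ?thesis .
qed

section \<open>Solutions of the moment equations\<close>

text \<open>The sum is the coefficient of degree \<open>card X - 1\<close> in the Lagrange
  interpolant of \<open>p\<close> on \<open>X\<close>; that interpolant is \<open>p\<close> itself,
  whose degree is smaller.\<close>

lemma sum_lagrange_eq_0:
  fixes X :: "'a::field set"
  assumes "finite X" "Suc (degree p) < card X"
  shows "(\<Sum>x\<in>X. poly p x / (\<Prod>y\<in>X - {x}. x - y)) = 0"
proof -
  define L where "L x = (\<Prod>y\<in>X - {x}. [:- y, 1:])" for x
  define q where "q = (\<Sum>x\<in>X. smult (poly p x / (\<Prod>y\<in>X - {x}. x - y)) (L x))"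
  have degL: "degree (L x) = card X - 1" and leadL: "lead_coeff (L x) = 1" if "x \<in> X" for x
    using that assms(1) by (simp_all only: L_def lead_coeff_prod) (simp_all add: degree_prod_eq_sum_degree)
  have polyL: "poly (L x) u = (if u = x then (\<Prod>y\<in>X - {x}. x - y) else 0)" if "u \<in> X" for x u
    using that assms(1) by (auto simp: L_def poly_prod)
  have "poly q u = poly p u" if u: "u \<in> X" for u
  proof -
    have "poly q u = (\<Sum>x\<in>X. if u = x then poly p u else 0)"
      unfolding q_def poly_sum using assms(1) by (intro sum.cong) (auto simp: polyL u)
    then show ?thesis using u assms(1) by simp
  qed
  moreover have degq: "degree q \<le> card X - 1"
    unfolding q_def using assms(1) by (intro degree_sum_le order_trans[OF degree_smult_le]) (auto simp: degL)
  ultimately have "q = p"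
    using assms by (intro poly_eqI_degree[of X]) auto
  then have "0 = coeff q (card X - 1)" using assms(2) by (simp add: coeff_eq_0)
  also have "\<dots> = (\<Sum>x\<in>X. poly p x / (\<Prod>y\<in>X - {x}. x - y))"
    unfolding q_def coeff_sum coeff_smult
  proof (intro sum.cong refl)
    fix x assume "x \<in> X"
    then have "coeff (L x) (card X - 1) = 1" using degL leadL by metis
    then show "poly p x / (\<Prod>y\<in>X - {x}. x - y) * coeff (L x) (card X - 1) =
        poly p x / (\<Prod>y\<in>X - {x}. x - y)" by simp
  qed
  finally show ?thesis by simp
qed

text \<open>For c_k the inverse of k times the product of k^2 - l^2 over the other l in
  \<open>S\<close>, the moment of order 2n + 1 is the divided difference of x^n at the squares,
  which vanishes for n < m.\<close>

lemma odd_moments_nontrivial: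
  assumes "finite S" "0 \<notin> S" "inj_on (\<lambda>k. k\<^sup>2) S" "m < card S"
  obtains c :: "int \<Rightarrow> complex" where "\<And>k. k \<in> S \<Longrightarrow> c k \<noteq> 0" "\<And>k. k \<notin> S \<Longrightarrow> c k = 0"
    "\<And>s. odd s \<Longrightarrow> s < 2 * m \<Longrightarrow> (\<Sum>k\<in>S. c k * of_int k ^ s) = 0"
proof -
  define sq where "sq k = (of_int (k\<^sup>2) :: complex)" for k
  have inj: "inj_on sq S"
    using assms(3) unfolding sq_def inj_on_def by (simp only: of_int_eq_iff)
  define P where "P k = (\<Prod>y\<in>sq ` S - {sq k}. sq k - y)" for k
  have P: "P k \<noteq> 0" for k using assms(1) by (simp add: P_def)
  define c where "c k = (if k \<in> S then 1 / (of_int k * P k) else 0)" for k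
  have "(\<Sum>k\<in>S. c k * of_int k ^ s) = 0" if "odd s" "s < 2 * m" for s
  proof -
    obtain n where n: "s = 2 * n + 1" using \<open>odd s\<close> by (auto elim: oddE)
    have "0 = (\<Sum>x\<in>sq ` S. poly (monom 1 n) x / (\<Prod>y\<in>sq ` S - {x}. x - y))"
      using that n assms(1,4) by (subst sum_lagrange_eq_0) (auto simp: degree_monom_eq card_image[OF inj])
    also have "\<dots> = (\<Sum>k\<in>S. sq k ^ n / P k)"
      by (simp add: sum.reindex[OF inj] poly_monom P_def)
    also have "\<dots> = (\<Sum>k\<in>S. c k * of_int k ^ s)"
    proof (intro sum.cong refl)
      fix k assume "k \<in> S"
      then have "k \<noteq> 0" using assms(2) by auto
      then show "sq k ^ n / P k = c k * of_int k ^ s"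
        using \<open>k \<in> S\<close> by (simp add: c_def n sq_def power_mult)
    qed
    finally show ?thesis by simp
  qed
  moreover have "c k \<noteq> 0" if "k \<in> S" for k
    using that assms(2) P by (auto simp: c_def)
  moreover have "c k = 0" if "k \<notin> S" for k
    using that by (simp add: c_def)
  ultimately show ?thesis using that by blast
qed

text \<open>The hypotheses make the sum of c_k k p(k^2) vanish for every \<open>p\<close> of degree
  below \<open>m\<close>; as the squares are distinct, such a \<open>p\<close> can vanish at all of
  them except that of \<open>k0\<close>.\<close>

lemma odd_moments_vanish_imp_zero:
  fixes c :: "int \<Rightarrow> complex"
  assumes "finite S" "0 \<notin> S" "inj_on (\<lambda>k. k\<^sup>2) S" "card S \<le> m"
    and c: "\<And>s. odd s \<Longrightarrow> s < 2 * m \<Longrightarrow> (\<Sum>k\<in>S. c k * of_int k ^ s) = 0" and "k0 \<in> S"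
  shows "c k0 = 0"
proof -
  define p :: "complex poly" where "p = (\<Prod>l\<in>S - {k0}. [:- of_int (l\<^sup>2), 1:])"
  have "degree p = card S - 1"
    using assms(1,6) by (simp add: p_def degree_prod_eq_sum_degree)
  then have deg: "degree p < m"
    using assms(1,4,6) card_gt_0_iff[of S] by (metis Suc_pred' empty_iff less_eq_Suc_le)
  have p_zero: "poly p (of_int (k\<^sup>2)) = 0" if "k \<in> S" "k \<noteq> k0" for k
    using that assms(1) by (auto simp: p_def poly_prod)
  have p_k0: "poly p (of_int (k0\<^sup>2)) \<noteq> 0"
  proof -
    have "k0\<^sup>2 \<noteq> l\<^sup>2" if "l \<in> S" "l \<noteq> k0" for l
      using inj_onD[OF assms(3)] that assms(6) by metis
    then have "(of_int (k0\<^sup>2) :: complex) \<noteq> of_int (l\<^sup>2)" if "l \<in> S" "l \<noteq> k0" for l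
      using that by (simp only: of_int_eq_iff) simp
    then show ?thesis using assms(1) by (auto simp: p_def poly_prod simp del: of_int_power)
  qed
  have "0 = (\<Sum>n\<le>degree p. coeff p n * (\<Sum>k\<in>S. c k * of_int k ^ (2 * n + 1)))"
    using deg by (intro sum.neutral[symmetric]) (simp add: c del: power_Suc)
  also have "\<dots> = (\<Sum>k\<in>S. \<Sum>n\<le>degree p. coeff p n * (c k * of_int k ^ (2 * n + 1)))"
    unfolding sum_distrib_left by (rule sum.swap)
  also have "\<dots> = (\<Sum>k\<in>S. c k * of_int k * poly p (of_int (k\<^sup>2)))"
    unfolding poly_altdef sum_distrib_left
    by (intro sum.cong refl) (simp add: mult_ac flip: power_mult)
  also have "\<dots> = (\<Sum>k\<in>{k0}. c k * of_int k * poly p (of_int (k\<^sup>2)))"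
    using assms(1,6) p_zero by (intro sum.mono_neutral_right) (auto simp del: of_int_power)
  finally have "c k0 * of_int k0 * poly p (of_int (k0\<^sup>2)) = 0" by simp
  moreover have "k0 \<noteq> 0" using assms(2,6) by auto
  ultimately show ?thesis using p_k0 by simp
qed

section \<open>Solutions at the two end weights\<close>

text \<open>Exchanging z and w negates the weights, takes the class of \<open>\<rho>\<close> to that
  of \<open>- \<rho>\<close>, and changes odd moments only by a sign.\<close>

lemma moments_vanish_flip:
  assumes "moments_vanish N m d c"
  shows "moments_vanish N m d (\<lambda>k. c (- k))"
  unfolding moments_vanish_def
proof (intro allI impI)
  fix s \<rho> assume s: "odd s \<and> s < 2 * m"
  have "(\<Sum>k | k \<in> weights d \<and> 2 * int N dvd k - \<rho>. c (- k) * of_int k ^ s) =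
      (\<Sum>k | k \<in> weights d \<and> 2 * int N dvd k - (- \<rho>). c k * of_int (- k) ^ s)"
  proof (rule sum.reindex_bij_witness[where i = uminus and j = uminus])
    fix k assume "k \<in> {k. k \<in> weights d \<and> 2 * int N dvd k - \<rho>}"
    moreover have "- k - (- \<rho>) = - (k - \<rho>)" by simp
    ultimately show "- k \<in> {k. k \<in> weights d \<and> 2 * int N dvd k - (- \<rho>)}"
      unfolding mem_Collect_eq weights_def by (simp only: dvd_minus_iff) simp
  next
    fix k assume "k \<in> {k. k \<in> weights d \<and> 2 * int N dvd k - (- \<rho>)}"
    moreover have "- k - \<rho> = - (k - (- \<rho>))" by simp
    ultimately show "- k \<in> {k. k \<in> weights d \<and> 2 * int N dvd k - \<rho>}"
      unfolding mem_Collect_eq weights_def by (simp only: dvd_minus_iff) simp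
  qed simp_all
  also have "\<dots> = - (\<Sum>k | k \<in> weights d \<and> 2 * int N dvd k - (- \<rho>). c k * of_int k ^ s)"
    using s by (simp add: power_minus_odd sum_negf)
  also have "(\<Sum>k | k \<in> weights d \<and> 2 * int N dvd k - (- \<rho>). c k * of_int k ^ s) = 0"
    using assms s unfolding moments_vanish_def by blast
  also have "- 0 = (0::complex)" by simp
  finally show "(\<Sum>k | k \<in> weights d \<and> 2 * int N dvd k - \<rho>. c (- k) * of_int k ^ s) = 0" .
qed

lemma moments_vanish_add_2:
  assumes "\<And>k. k \<in> weights d \<Longrightarrow> c' k = c k" "c' (int (d + 2)) = 0" "c' (- int (d + 2)) = 0"
  shows "moments_vanish N m (d + 2) c' \<longleftrightarrow> moments_vanish N m d c"
proof -
  have W: "weights (d + 2) = insert (int (d + 2)) (insert (- int (d + 2)) (weights d))"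
    by (auto simp: weights_def) presburger+
  have "(\<Sum>k | k \<in> weights (d + 2) \<and> 2 * int N dvd k - \<rho>. c' k * of_int k ^ s) =
      (\<Sum>k | k \<in> weights d \<and> 2 * int N dvd k - \<rho>. c k * of_int k ^ s)" for s \<rho>
    using assms unfolding W by (intro sum.mono_neutral_cong_right) (auto simp del: of_nat_add)
  then show ?thesis by (simp only: moments_vanish_def)
qed

text \<open>The m + 1 weights d, d - 2N, ..., d - 2mN lie in one class and, by mN \<le> d, not below
  -d. They carry a nontrivial solution because their squares are distinct and nonzero.\<close>

lemma moments_vanish_end_nontrivial:
  assumes "N > 0" "m * N \<le> d" and *: "\<And>t. t \<le> 2 * m \<Longrightarrow> d \<noteq> t * N"
  obtains c where "moments_vanish N m d c" "c (int d) \<noteq> 0" "c (- int d) = 0"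
proof -
  define k where "k i = int d - 2 * int N * int i" for i
  define S where "S = k ` {..m}"
  \<comment> \<open>This sum is 2 (d - (i + j) N) with i + j \<le> 2m. It being nonzero excludes the
    weight 0 (i = j), makes the squares distinct, and keeps -d out of \<open>S\<close> (i =
    0).\<close>
  have sum_ne: "k i + k j \<noteq> 0" if "i \<le> m" "j \<le> m" for i j
  proof
    assume "k i + k j = 0"
    then have "int d = int ((i + j) * N)" by (simp add: k_def algebra_simps)
    then show False using *[of "i + j"] that by (simp only: of_nat_eq_iff)
  qed
  have inj: "inj_on k {..m}" using assms(1) by (auto simp: k_def inj_on_def)
  have zero: "0 \<notin> S"
  proof
    assume "0 \<in> S"
    then obtain i where "i \<le> m" "k i = 0" unfolding S_def by auto
    then show False using sum_ne[of i i] by simp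
  qed
  have sq: "inj_on (\<lambda>k. k\<^sup>2) S"
  proof (rule inj_onI)
    fix x y assume "x \<in> S" "y \<in> S" "x\<^sup>2 = y\<^sup>2"
    moreover have "x + y \<noteq> 0"
      using \<open>x \<in> S\<close> \<open>y \<in> S\<close> sum_ne unfolding S_def by blast
    ultimately show "x = y" by (auto simp: power2_eq_iff)
  qed
  have card: "m < card S" by (simp add: S_def card_image[OF inj])
  have fin: "finite S" by (simp add: S_def)
  obtain c :: "int \<Rightarrow> complex" where c: "\<And>k. k \<in> S \<Longrightarrow> c k \<noteq> 0" "\<And>k. k \<notin> S \<Longrightarrow> c k = 0"
    "\<And>s. odd s \<Longrightarrow> s < 2 * m \<Longrightarrow> (\<Sum>k\<in>S. c k * of_int k ^ s) = 0"
    by (rule odd_moments_nontrivial[OF fin zero sq card]) blast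
  have d: "int d \<in> S" unfolding S_def by (rule image_eqI[of _ _ 0]) (simp_all add: k_def)
  have "- int d \<notin> S"
    using sum_ne[of 0] by (auto simp: S_def k_def)
  have SW: "S \<subseteq> weights d"
  proof
    fix x assume "x \<in> S"
    then obtain i where i: "i \<le> m" "x = k i" unfolding S_def by blast
    then have "i * N \<le> d" using assms(2) mult_le_mono1[of i m N] by linarith
    then have "int N * int i \<le> int d" by (metis mult.commute of_nat_le_iff of_nat_mult)
    moreover have "0 \<le> int N * int i" by simp
    ultimately have "\<bar>int d - 2 * (int N * int i)\<bar> \<le> int d" by linarith
    then show "x \<in> weights d" by (simp add: weights_def i k_def mult.assoc)
  qed
  have S_cong: "2 * int N dvd x - int d" if "x \<in> S" for x
    using that by (auto simp: S_def k_def)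
  have "moments_vanish N m d c"
    unfolding moments_vanish_def
  proof (intro allI impI)
    fix s \<rho> assume s: "odd s \<and> s < 2 * m"
    let ?T = "{k. k \<in> weights d \<and> 2 * int N dvd k - \<rho>}"
    show "(\<Sum>k\<in>?T. c k * of_int k ^ s) = 0"
    proof (cases "2 * int N dvd int d - \<rho>")
      case True
      have "x \<in> ?T" if "x \<in> S" for x
        using dvd_add[OF S_cong[OF that] True] SW that by auto
      then have "(\<Sum>k\<in>?T. c k * of_int k ^ s) = (\<Sum>k\<in>S. c k * of_int k ^ s)"
        by (intro sum.mono_neutral_right) (auto simp: c(2))
      then show ?thesis using c(3) s by simp
    next
      case False
      have "x \<notin> S" if "x \<in> ?T" for x
        using dvd_diff[of "2 * int N" "x - \<rho>" "x - int d"] S_cong[of x] that False by auto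
      then show ?thesis using c(2) by (intro sum.neutral) auto
    qed
  qed
  then show ?thesis using that c(1)[OF d] c(2)[OF \<open>- int d \<notin> S\<close>] by blast
qed

lemma weights_congruent_obtain:
  assumes "k \<in> weights d" "2 * int N dvd k - int d" "N > 0"
  obtains i where "k = int d - 2 * int N * int i"
proof -
  obtain t where t: "k - int d = 2 * int N * t" using assms(2) by blast
  have "k - int d \<le> 0" using assms(1) by (auto simp: weights_def)
  then have "2 * int N * t \<le> 0" by (simp only: t)
  then have "t \<le> 0" using assms(3) by (simp add: mult_le_0_iff)
  then have "k = int d - 2 * int N * int (nat (- t))" using t by simp
  then show ?thesis using that by blast
qed

text \<open>The weights d - 2Ni in the class of d satisfy iN \<le> d < mN, so there are at most m of
  them. Two of them with sum 0 would force N to divide d, hence the squares are distinct and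
  nonzero.\<close>

lemma moments_vanish_end_zero:
  assumes "N > 0" "\<not> N dvd d" "d < m * N" "moments_vanish N m d c"
  shows "c (int d) = 0"
proof (rule odd_moments_vanish_imp_zero)
  let ?S = "{k. k \<in> weights d \<and> 2 * int N dvd k - int d}"
  have sum_ne: "x + y \<noteq> 0" if "x \<in> ?S" "y \<in> ?S" for x y
  proof
    assume "x + y = 0"
    have "2 * int N dvd (x - int d) + (y - int d)" using that by (intro dvd_add) auto
    also have "(x - int d) + (y - int d) = 2 * - int d" using \<open>x + y = 0\<close> by simp
    finally have "int N dvd int d" by simp
    then show False using assms(2) by simp
  qed
  show "0 \<notin> ?S" using sum_ne[of 0 0] by auto
  show "inj_on (\<lambda>k. k\<^sup>2) ?S"
  proof (rule inj_onI)
    fix x y assume "x \<in> ?S" "y \<in> ?S" "x\<^sup>2 = y\<^sup>2"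
    moreover have "x + y \<noteq> 0" using \<open>x \<in> ?S\<close> \<open>y \<in> ?S\<close> by (rule sum_ne)
    ultimately show "x = y" by (auto simp: power2_eq_iff)
  qed
  have "?S \<subseteq> (\<lambda>i. int d - 2 * int N * int i) ` {..<m}"
  proof
    fix x assume x: "x \<in> ?S"
    then obtain i where i: "x = int d - 2 * int N * int i"
      using weights_congruent_obtain assms(1) by blast
    then have "int N * int i \<le> int d" using x by (auto simp: weights_def)
    then have "i * N \<le> d" by (metis mult.commute of_nat_le_iff of_nat_mult)
    then have "i < m" using assms(3) by (meson le_less_trans mult_less_cancel2)
    then show "x \<in> (\<lambda>i. int d - 2 * int N * int i) ` {..<m}" using i by blast
  qed
  then show "card ?S \<le> m" using surj_card_le[of "{..<m}"] by fastforce
  show "int d \<in> ?S" by (simp add: weights_def)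
  show "(\<Sum>k\<in>?S. c k * of_int k ^ s) = 0" if "odd s" "s < 2 * m" for s
    using assms(4) that unfolding moments_vanish_def by blast
qed simp

text \<open>When N divides d, the class of d mod 2N is closed under negation, so odd moments see
  only c_k - c_{-k} on positive weights. The positive weights d - 2Ni have 2iN < d \<le> 2mN, so
  there are at most m.\<close>

lemma moments_vanish_ends_eq:
  assumes "N > 0" "N dvd d" "0 < d" "d \<le> 2 * m * N" "moments_vanish N m d c"
  shows "c (int d) = c (- int d)"
proof -
  let ?T = "{k. k \<in> weights d \<and> 2 * int N dvd k - int d}"
  let ?S = "{k. k \<in> ?T \<and> k > 0}"
  have uminus: "- k \<in> ?T" if "k \<in> ?T" for k
  proof -
    have "2 * int N dvd 2 * int d" using assms(2) by simp
    then have "2 * int N dvd - ((k - int d) + 2 * int d)"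
      using that by (intro iffD2[OF dvd_minus_iff] dvd_add) auto
    also have "- ((k - int d) + 2 * int d) = - k - int d" by simp
    finally show ?thesis using that by (simp add: weights_def)
  qed
  have "c (int d) - c (- int d) = 0"
  proof (rule odd_moments_vanish_imp_zero[of ?S m "\<lambda>k. c k - c (- k)"])
    show "inj_on (\<lambda>k. k\<^sup>2) ?S"
      by (auto simp: inj_on_def power2_eq_iff)
    have "?S \<subseteq> (\<lambda>i. int d - 2 * int N * int i) ` {..<m}"
    proof
      fix x assume x: "x \<in> ?S"
      then obtain i where i: "x = int d - 2 * int N * int i"
        using weights_congruent_obtain assms(1) by blast
      then have "int (2 * i * N) < int d" using x by (simp add: mult_ac)
      then have "2 * i * N < 2 * m * N" using assms(4) by (simp only: of_nat_less_iff)
      then have "i < m" by simp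
      then show "x \<in> (\<lambda>i. int d - 2 * int N * int i) ` {..<m}" using i by blast
    qed
    then show "card ?S \<le> m" using surj_card_le[of "{..<m}"] by fastforce
    show "int d \<in> ?S" using assms(3) by (simp add: weights_def)
    show "(\<Sum>k\<in>?S. (c k - c (- k)) * of_int k ^ s) = 0" if s: "odd s" "s < 2 * m" for s
    proof -
      let ?g = "\<lambda>k. c k * of_int k ^ s"
      have "(\<Sum>k\<in>?S. (c k - c (- k)) * of_int k ^ s) = (\<Sum>k\<in>?S. ?g k + ?g (- k))"
        using s(1) by (intro sum.cong refl) (simp add: power_minus_odd algebra_simps)
      also have "\<dots> = (\<Sum>k\<in>?S. ?g k) + (\<Sum>k\<in>?S. ?g (- k))"
        by (rule sum.distrib)
      also have "(\<Sum>k\<in>?S. ?g (- k)) = (\<Sum>k | k \<in> ?T \<and> k < 0. ?g k)"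
        by (rule sum.reindex_bij_witness[where i = uminus and j = uminus]) (use uminus in auto)
      also have "(\<Sum>k\<in>?S. ?g k) + \<dots> = (\<Sum>k\<in>?S \<union> {k. k \<in> ?T \<and> k < 0}. ?g k)"
        by (rule sum.union_disjoint[symmetric]) auto
      \<comment> \<open>A weight 0 contributes nothing because s is odd.\<close>
      also have "\<dots> = (\<Sum>k\<in>?T. ?g k)"
        using s(1) by (intro sum.mono_neutral_left) (auto simp: odd_pos)
      also have "\<dots> = 0"
        using assms(5) s unfolding moments_vanish_def by blast
      finally show ?thesis .
    qed
  qed auto
  then show ?thesis by simp
qed

text \<open>For d > 0 these are the coefficients of the invariant z^d + w^d: the weights d and -d
  share a class mod 2N and cancel in odd moments.\<close>

lemma moments_vanish_power_sum:
  assumes "N dvd d"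
  shows "moments_vanish N m d (\<lambda>k. if \<bar>k\<bar> = int d then 1 else 0)"
  unfolding moments_vanish_def
proof (intro allI impI)
  fix s \<rho> assume s: "odd s \<and> s < 2 * m"
  let ?f = "\<lambda>k. (if \<bar>k\<bar> = int d then 1 else 0) * of_int k ^ s :: complex"
  let ?T = "{k. k \<in> weights d \<and> 2 * int N dvd k - \<rho>}"
  show "(\<Sum>k\<in>?T. ?f k) = 0"
  \<comment> \<open>For d = 0 the two ends coincide and nothing cancels; the only term is 0^s =
    0.\<close>
  proof (cases "d = 0")
    case True
    then show ?thesis using s by (intro sum.neutral) (auto simp: odd_pos)
  next
    case False
    have "2 * int N dvd 2 * int d" using assms by simp
    then have "int d \<in> ?T \<longleftrightarrow> - int d \<in> ?T"
      using dvd_diff[of "2 * int N" "int d - \<rho>" "2 * int d"] dvd_add[of "2 * int N" "- int d - \<rho>" "2 * int d"]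
      by (auto simp: weights_def)
    then consider "int d \<in> ?T" "- int d \<in> ?T" | "int d \<notin> ?T" "- int d \<notin> ?T" by blast
    then show ?thesis
    proof cases
      case 1
      then have "(\<Sum>k\<in>?T. ?f k) = (\<Sum>k\<in>{int d, - int d}. ?f k)"
        by (intro sum.mono_neutral_right) auto
      also have "\<dots> = 0" using s False by (simp add: power_minus_odd)
      finally show ?thesis .
    next
      case 2
      have "\<bar>k\<bar> \<noteq> int d" if "k \<in> ?T" for k
      proof
        assume "\<bar>k\<bar> = int d"
        then have "k = int d \<or> k = - int d" by linarith
        then show False using 2 that by metis
      qed
      then show ?thesis by (intro sum.neutral) auto
    qed
  qed
qed

section \<open>The Poincare series\<close>

text \<open>The points \<open>(1/2, -i/2)\<close> and \<open>(1/2, i/2)\<close> have \<open>(z, w) = (1, 0)\<close> and \<open>(0, 1)\<close>, so evaluation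
  there extracts the coefficients of \<open>z\<^sup>d\<close> and \<open>w\<^sup>d\<close>.\<close>

definition end_coeff :: "complex \<Rightarrow> bipoly \<Rightarrow> complex" where
  "end_coeff u q = coeff (subst2 [:1/2:] [:u:] q) 0"

lemma end_coeff_add: "end_coeff u (p + q) = end_coeff u p + end_coeff u q"
  by (simp add: end_coeff_def)

lemma end_coeff_smult: "end_coeff u (smult [:c:] q) = c * end_coeff u q"
  unfolding end_coeff_def by (simp only: subst2_smult pcompose_const) simp

lemma end_coeff_zw_form:
  "end_coeff (- (\<i>/2)) (zw_form d c) = c (int d)"
  "end_coeff (\<i>/2) (zw_form d c) = c (- int d)"
proof -
  have sum: "end_coeff u (zw_form d c) =
      (\<Sum>a\<le>d. c (2 * int a - int d) * end_coeff u (z_poly ^ a * w_poly ^ (d - a)))" for u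
  proof -
    have "end_coeff u (sum f A) = (\<Sum>a\<in>A. end_coeff u (f a))" for f and A :: "nat set"
      by (simp add: end_coeff_def subst2_sum coeff_sum)
    then show ?thesis by (simp only: zw_form_def end_coeff_smult)
  qed
  have "end_coeff (- (\<i>/2)) (z_poly ^ a * w_poly ^ (d - a)) = (if a = d then 1 else 0)" if "a \<le> d" for a
    using that by (auto simp: end_coeff_def z_poly_def w_poly_def pcompose_pCons coeff_mult_0 coeff_0_power)
  then show "end_coeff (- (\<i>/2)) (zw_form d c) = c (int d)"
    by (simp add: sum if_distrib[of "\<lambda>x. _ * x"] cong: if_cong)
  have "end_coeff (\<i>/2) (z_poly ^ a * w_poly ^ (d - a)) = (if a = 0 then 1 else 0)" if "a \<le> d" for a
    using that by (auto simp: end_coeff_def z_poly_def w_poly_def pcompose_pCons coeff_mult_0 coeff_0_power)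
  then show "end_coeff (\<i>/2) (zw_form d c) = c (- int d)"
    by (simp add: sum if_distrib[of "\<lambda>x. _ * x"] cong: if_cong)
qed

definition homogeneous_quasiinvariants :: "nat \<Rightarrow> nat \<Rightarrow> nat \<Rightarrow> bipoly set" where
  "homogeneous_quasiinvariants N m d = {q \<in> quasiinvariants N m. homogeneous_of_degree d q}"

lemma homogeneous_quasiinvariants_eq:
  assumes "N > 0"
  shows "homogeneous_quasiinvariants N m d = {zw_form d c | c. moments_vanish N m d c}"
  unfolding homogeneous_quasiinvariants_def
  using zw_form_in_quasiinvariants_iff[OF assms] homogeneous_imp_zw_form homogeneous_zw_form by blast

lemma subspace_homogeneous_quasiinvariants:
  assumes "N > 0"
  shows "bipoly.subspace (homogeneous_quasiinvariants N m d)"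
proof -
  have "moments_vanish N m d (\<lambda>_. 0)" by (simp add: moments_vanish_def)
  moreover have "moments_vanish N m d (\<lambda>k. c k + c' k)"
    if "moments_vanish N m d c" "moments_vanish N m d c'" for c c'
    using that by (simp add: moments_vanish_def distrib_right sum.distrib)
  moreover have "moments_vanish N m d (\<lambda>k. x * c k)" if "moments_vanish N m d c" for c x
    using that by (simp add: moments_vanish_def mult.assoc flip: sum_distrib_left)
  ultimately show ?thesis
    unfolding homogeneous_quasiinvariants_eq[OF assms] bipoly.subspace_def
    by (auto simp: zw_form_add zw_form_smult simp flip: zw_form_0[of d])
qed

text \<open>A form is divisible by zw exactly when its coefficients of z^d and w^d vanish; the
  condition on coefficients makes the codimension accessible.\<close>

definition zw_multiples :: "nat \<Rightarrow> nat \<Rightarrow> nat \<Rightarrow> bipoly set" where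
  "zw_multiples N m d = {q \<in> homogeneous_quasiinvariants N m d.
     end_coeff (- (\<i>/2)) q = 0 \<and> end_coeff (\<i>/2) q = 0}"

lemma zw_multiples_eq:
  assumes "N > 0"
  shows "zw_multiples N m d =
    {zw_form d c | c. moments_vanish N m d c \<and> c (int d) = 0 \<and> c (- int d) = 0}"
  unfolding zw_multiples_def homogeneous_quasiinvariants_eq[OF assms]
  by (auto simp: end_coeff_zw_form)

lemma zw_multiples_low:
  assumes "N > 0" "d < 2"
  shows "zw_multiples N m d = {0}"
proof -
  consider "d = 0" | "d = 1" using assms(2) by linarith
  then have "zw_form d c = 0" if "c (int d) = 0" "c (- int d) = 0" for c
    by cases (use that in \<open>simp_all add: zw_form_def\<close>)
  moreover have "moments_vanish N m d (\<lambda>_. 0)" by (simp add: moments_vanish_def)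
  ultimately show ?thesis
    unfolding zw_multiples_eq[OF assms(1)] using zw_form_0[of d, symmetric] by fastforce
qed

lemma zw_multiples_add_2:
  assumes "N > 0"
  shows "zw_multiples N m (d + 2) = (*) (z_poly * w_poly) ` homogeneous_quasiinvariants N m d"
proof -
  \<comment> \<open>The ends are set to 0 because \<open>c\<close> is arbitrary outside the weights
    of degree \<open>d\<close>.\<close>
  define ext where "ext c k = (if \<bar>k\<bar> = int (d + 2) then 0 else c k)" for c :: "int \<Rightarrow> complex" and k
  have mult: "z_poly * w_poly * zw_form d c = zw_form (d + 2) (ext c)" for c
  proof -
    have "z_poly * w_poly * zw_form d c = zw_form (d + 2) (\<lambda>k. if k = - int (Suc (Suc d)) then 0
        else if k - 1 = int (Suc d) then 0 else c (k - 1 + 1))"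
      by (simp only: mult.assoc w_mult_zw_form z_mult_zw_form add_2_eq_Suc')
    also have "(\<lambda>k. if k = - int (Suc (Suc d)) then 0 else if k - 1 = int (Suc d) then 0 else c (k - 1 + 1)) = ext c"
      by (auto simp: ext_def fun_eq_iff)
    finally show ?thesis .
  qed
  have ext_ends: "ext c (int (d + 2)) = 0" "ext c (- int (d + 2)) = 0" for c
    by (simp_all add: ext_def)
  have "ext c k = c k" if "k \<in> weights d" for c k
    using that by (auto simp: ext_def weights_def)
  then have ext_iff: "moments_vanish N m (d + 2) (ext c) \<longleftrightarrow> moments_vanish N m d c" for c
    using ext_ends by (rule moments_vanish_add_2)
  have ext_id: "ext c = c" if "c (int (d + 2)) = 0" "c (- int (d + 2)) = 0" for c
  proof
    fix k
    have "k = int (d + 2) \<or> k = - int (d + 2)" if "\<bar>k\<bar> = int (d + 2)"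
      using that by linarith
    then show "ext c k = c k" using that unfolding ext_def by metis
  qed
  show ?thesis
  proof
    show "zw_multiples N m (d + 2) \<subseteq> (*) (z_poly * w_poly) ` homogeneous_quasiinvariants N m d"
    proof
      fix q assume "q \<in> zw_multiples N m (d + 2)"
      then obtain c where c: "q = zw_form (d + 2) c" "moments_vanish N m (d + 2) c"
          "c (int (d + 2)) = 0" "c (- int (d + 2)) = 0"
        unfolding zw_multiples_eq[OF assms] by blast
      have "moments_vanish N m d c" using c(2) ext_iff[of c] by (simp only: ext_id[OF c(3,4)])
      moreover have "q = z_poly * w_poly * zw_form d c" by (simp only: mult c(1) ext_id[OF c(3,4)])
      ultimately show "q \<in> (*) (z_poly * w_poly) ` homogeneous_quasiinvariants N m d"
        unfolding homogeneous_quasiinvariants_eq[OF assms] by blast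
    qed
    show "(*) (z_poly * w_poly) ` homogeneous_quasiinvariants N m d \<subseteq> zw_multiples N m (d + 2)"
    proof
      fix q assume "q \<in> (*) (z_poly * w_poly) ` homogeneous_quasiinvariants N m d"
      then obtain c where c: "q = z_poly * w_poly * zw_form d c" "moments_vanish N m d c"
        unfolding homogeneous_quasiinvariants_eq[OF assms] by blast
      then show "q \<in> zw_multiples N m (d + 2)"
        unfolding zw_multiples_eq[OF assms] mult using ext_iff ext_ends by blast
    qed
  qed
qed

text \<open>The codimension of the multiples of zw among the quasiinvariants of degree
  \<open>d\<close>, that is, the dimension of the space of possible pairs of end
  coefficients.\<close>

definition new_generators :: "nat \<Rightarrow> nat \<Rightarrow> nat \<Rightarrow> nat" where
  "new_generators N m d =
     (if N dvd d then if (2 * m + 1) * N \<le> d then 2 else 1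
      else if m * N \<le> d then 2 else 0)"

text \<open>From \<open>?V\<close> through \<open>?V'\<close> to \<open>zw_multiples\<close> one end
  condition is imposed at a time, and each functional that is nonzero accounts for one dimension.
  Degree 0, where both ends are the same weight, is treated separately.\<close>

lemma has_basis_homogeneous_quasiinvariants:
  assumes "N > 0" "0 < d" "has_basis_of_size (zw_multiples N m d) n"
  shows "has_basis_of_size (homogeneous_quasiinvariants N m d) (n + new_generators N m d)"
proof -
  let ?V = "homogeneous_quasiinvariants N m d"
  let ?V' = "{q \<in> ?V. end_coeff (- (\<i>/2)) q = 0}"
  note V_eq = homogeneous_quasiinvariants_eq[OF assms(1), of m d]
  note sub = subspace_homogeneous_quasiinvariants[OF assms(1), of m d]
  have sub': "bipoly.subspace ?V'"
  proof -
    have "end_coeff (- (\<i>/2)) 0 = 0" by (simp add: end_coeff_def)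
    then show ?thesis
      using sub unfolding bipoly.subspace_def by (auto simp: end_coeff_add end_coeff_smult)
  qed
  have U: "has_basis_of_size {q \<in> ?V'. end_coeff (\<i>/2) q = 0} n"
    using assms(3) unfolding zw_multiples_def by (simp add: conj_assoc)
  \<comment> \<open>A solution that is nonzero at d and zero at -d, together with its image under k
    \<mapsto> -k, makes both functionals nonzero.\<close>
  have two: "has_basis_of_size ?V (Suc (Suc n))"
    if ge: "m * N \<le> d" and ne: "\<And>t. t \<le> 2 * m \<Longrightarrow> d \<noteq> t * N"
  proof -
    obtain c where c: "moments_vanish N m d c" "c (int d) \<noteq> 0" "c (- int d) = 0"
      using moments_vanish_end_nontrivial[OF assms(1) ge ne] by blast
    have "zw_form d (\<lambda>k. c (- k)) \<in> ?V'"
      using moments_vanish_flip[OF c(1)] c(3) unfolding V_eq by (auto simp: end_coeff_zw_form)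
    moreover have "end_coeff (\<i>/2) (zw_form d (\<lambda>k. c (- k))) \<noteq> 0"
      using c(2) by (simp add: end_coeff_zw_form)
    ultimately have V': "has_basis_of_size ?V' (Suc n)"
      by (rule has_basis_of_size_kernel_Suc[OF U sub' _ _ end_coeff_add end_coeff_smult])
    have "zw_form d c \<in> ?V" using c(1) unfolding V_eq by blast
    moreover have "end_coeff (- (\<i>/2)) (zw_form d c) \<noteq> 0" using c(2) by (simp add: end_coeff_zw_form)
    ultimately show ?thesis
      by (rule has_basis_of_size_kernel_Suc[OF V' sub _ _ end_coeff_add end_coeff_smult])
  qed
  show ?thesis
  proof (cases "N dvd d")
    case True
    then obtain u where u: "d = u * N" by (metis dvd_def mult.commute)
    show ?thesis
    proof (cases "(2 * m + 1) * N \<le> d")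
      case ge: True
      have "m * N \<le> (2 * m + 1) * N" by (rule mult_le_mono1) simp
      moreover have "2 * m + 1 \<le> u" using ge assms(1) unfolding u mult_le_cancel2 by simp
      then have "d \<noteq> t * N" if "t \<le> 2 * m" for t
        using that assms(1) unfolding u by auto
      ultimately show ?thesis using two ge True by (simp add: new_generators_def)
    next
      case False
      then have "u \<le> 2 * m" unfolding u mult_le_cancel2 by simp
      then have le: "d \<le> 2 * m * N" unfolding u by (rule mult_le_mono1)
      \<comment> \<open>Equal ends mean that one condition implies the other, so \<open>?V'\<close>
        already equals \<open>zw_multiples\<close>; z^d + w^d supplies the single missing
        dimension.\<close>
      have "end_coeff (- (\<i>/2)) q = end_coeff (\<i>/2) q" if q: "q \<in> ?V" for q
      proof -
        obtain c where c: "q = zw_form d c" "moments_vanish N m d c"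
          using q unfolding V_eq by blast
        show ?thesis
          using moments_vanish_ends_eq[OF assms(1) True assms(2) le c(2)]
          by (simp add: c(1) end_coeff_zw_form)
      qed
      then have "?V' = {q \<in> ?V'. end_coeff (\<i>/2) q = 0}" by auto
      then have V': "has_basis_of_size ?V' n" using U by simp
      let ?c = "\<lambda>k. if \<bar>k\<bar> = int d then 1 else 0"
      have "zw_form d ?c \<in> ?V" unfolding V_eq using moments_vanish_power_sum[OF True] by blast
      moreover have "end_coeff (- (\<i>/2)) (zw_form d ?c) \<noteq> 0" by (simp add: end_coeff_zw_form)
      ultimately have "has_basis_of_size ?V (Suc n)"
        by (rule has_basis_of_size_kernel_Suc[OF V' sub _ _ end_coeff_add end_coeff_smult])
      then show ?thesis using True False by (simp add: new_generators_def)
    qed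
  next
    case nd: False
    show ?thesis
    proof (cases "m * N \<le> d")
      case True
      moreover have "d \<noteq> t * N" for t using nd by auto
      ultimately show ?thesis using two nd by (simp add: new_generators_def)
    next
      case False
      then have "c (int d) = 0 \<and> c (- int d) = 0" if "moments_vanish N m d c" for c
        using moments_vanish_end_zero[OF assms(1) nd _ that]
          moments_vanish_end_zero[OF assms(1) nd _ moments_vanish_flip[OF that]] by simp
      then have "zw_multiples N m d = ?V"
        unfolding zw_multiples_eq[OF assms(1)] V_eq by blast
      then show ?thesis using assms(3) nd False by (simp add: new_generators_def)
    qed
  qed
qed

section \<open>Dimension recursion and generating functions\<close>

fun quasi_dim :: "nat \<Rightarrow> nat \<Rightarrow> nat \<Rightarrow> nat" where
  "quasi_dim N m 0 = new_generators N m 0"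
| "quasi_dim N m (Suc 0) = new_generators N m (Suc 0)"
| "quasi_dim N m (Suc (Suc d)) = quasi_dim N m d + new_generators N m (Suc (Suc d))"

lemma has_basis_quasi_dim:
  assumes "N > 0"
  shows "has_basis_of_size (homogeneous_quasiinvariants N m d) (quasi_dim N m d)"
proof (induction d rule: induct_nat_012)
  case 0
  let ?V = "homogeneous_quasiinvariants N m 0"
  note V_eq = homogeneous_quasiinvariants_eq[OF assms, of m 0]
  \<comment> \<open>In degree 0 both functionals read off the same coefficient, so one kernel
    suffices.\<close>
  have "{q \<in> ?V. end_coeff (- (\<i>/2)) q = 0} = zw_multiples N m 0"
    unfolding V_eq zw_multiples_eq[OF assms] by (auto simp: end_coeff_zw_form)
  then have ker: "has_basis_of_size {q \<in> ?V. end_coeff (- (\<i>/2)) q = 0} 0"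
    using has_basis_of_size_zero zw_multiples_low[OF assms, of 0] by simp
  let ?c = "\<lambda>k. if \<bar>k\<bar> = int 0 then 1 else 0"
  have "zw_form 0 ?c \<in> ?V"
    unfolding V_eq using moments_vanish_power_sum[of N 0] by blast
  moreover have "end_coeff (- (\<i>/2)) (zw_form 0 ?c) \<noteq> 0" by (simp add: end_coeff_zw_form)
  ultimately have "has_basis_of_size ?V (Suc 0)"
    by (rule has_basis_of_size_kernel_Suc[OF ker subspace_homogeneous_quasiinvariants[OF assms]
          _ _ end_coeff_add end_coeff_smult])
  then show ?case using assms by (simp add: new_generators_def)
next
  case 1
  have "has_basis_of_size (zw_multiples N m 1) 0"
    using has_basis_of_size_zero zw_multiples_low[OF assms, of 1] by simp
  from has_basis_homogeneous_quasiinvariants[OF assms _ this] show ?case by simp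
next
  case (ge2 d)
  have "z_poly * w_poly \<noteq> 0" by (simp add: z_poly_def w_poly_def)
  then have "has_basis_of_size (zw_multiples N m (Suc (Suc d))) (quasi_dim N m d)"
    using has_basis_of_size_mult[OF ge2(1)] zw_multiples_add_2[OF assms, of m d] by simp
  from has_basis_homogeneous_quasiinvariants[OF assms _ this] show ?case by simp
qed

lemma poincare_series_quasiinvariants:
  assumes "N > 0"
  shows "poincare_series (quasiinvariants N m) = Abs_fps (\<lambda>d. of_nat (quasi_dim N m d))"
  unfolding poincare_series_def
  using has_basis_of_size_imp_dim[OF has_basis_quasi_dim[OF assms]]
  by (simp add: homogeneous_quasiinvariants_def)

lemma quasi_dim_fps:
  "Abs_fps (\<lambda>d. of_nat (quasi_dim N m d)) * (1 - fps_X ^ 2) =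
   (Abs_fps (\<lambda>d. of_nat (new_generators N m d)) :: rat fps)"
proof (rule fps_ext)
  fix d
  have "of_nat (quasi_dim N m d) - (if d < 2 then 0 else of_nat (quasi_dim N m (d - 2))) =
      (of_nat (new_generators N m d) :: rat)"
    by (cases "(N, m, d)" rule: quasi_dim.cases) auto
  moreover have "(Abs_fps (\<lambda>d. of_nat (quasi_dim N m d)) * (1 - fps_X ^ 2) :: rat fps) $ d =
      of_nat (quasi_dim N m d) - (if d < 2 then 0 else of_nat (quasi_dim N m (d - 2)))"
    by (simp add: right_diff_distrib fps_X_power_mult_right_nth)
  ultimately show "(Abs_fps (\<lambda>d. of_nat (quasi_dim N m d)) * (1 - fps_X ^ 2)) $ d =
      (Abs_fps (\<lambda>d. of_nat (new_generators N m d)) :: rat fps) $ d"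
    by simp
qed

text \<open>Along each residue class mod N, \<open>new_generators\<close> is a step function, and
  the factor 1 - t^N records its jumps: by 2 at the first d \<ge> mN of a nonzero class, by 1 at 0
  and at (2m + 1)N in the zero class.\<close>

lemma new_generators_fps:
  assumes "N > 0"
  shows "(Abs_fps (\<lambda>d. of_nat (new_generators N m d)) :: rat fps) * (1 - fps_X ^ N) =
    1 + (\<Sum>j=1..N-1. 2 * fps_X ^ (m * N + j)) + fps_X ^ ((2 * m + 1) * N)"
proof (rule fps_ext)
  fix d
  let ?G = "\<lambda>d. of_nat (new_generators N m d) :: rat"
  have "(\<Sum>j=1..N-1. 2 * fps_X ^ (m * N + j) :: rat fps) $ d =
      (\<Sum>j=1..N-1. if j = d - m * N \<and> m * N \<le> d then 2 else 0)"
    unfolding fps_sum_nth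
  proof (intro sum.cong refl)
    fix j
    have "(2 * fps_X ^ (m * N + j) :: rat fps) $ d = 2 * (if d = m * N + j then 1 else 0)"
      by (simp only: numeral_fps_const fps_mult_left_const_nth fps_X_power_nth)
    then show "(2 * fps_X ^ (m * N + j) :: rat fps) $ d = (if j = d - m * N \<and> m * N \<le> d then 2 else 0)"
      by auto
  qed
  also have "\<dots> = (if m * N < d \<and> d < m * N + N then 2 else 0)"
  proof (cases "m * N \<le> d")
    case True
    then show ?thesis by (auto simp: sum.delta)
  qed auto
  finally have mid: "(\<Sum>j=1..N-1. 2 * fps_X ^ (m * N + j) :: rat fps) $ d =
      (if m * N < d \<and> d < m * N + N then 2 else 0)" .
  have "?G d - (if d < N then 0 else ?G (d - N)) =
      (if d = 0 then 1 else 0) + (if m * N < d \<and> d < m * N + N then 2 else 0) +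
      (if d = (2 * m + 1) * N then 1 else 0)"
  proof (cases "N dvd d")
    case True
    then obtain t where t: "d = t * N" by (metis dvd_def mult.commute)
    have cmp: "u * N \<le> v * N \<longleftrightarrow> u \<le> v" "u * N < v * N \<longleftrightarrow> u < v" "u * N = v * N \<longleftrightarrow> u = v" for u v
      using assms by auto
    have "?G d = (if 2 * m + 1 \<le> t then 2 else 1)"
      unfolding t new_generators_def by (simp only: cmp) simp
    moreover have "?G (d - N) = (if 2 * m + 1 \<le> t - 1 then 2 else 1)" if "t \<ge> 1"
    proof -
      have "d - N = (t - 1) * N" using t by (simp add: diff_mult_distrib)
      then show ?thesis unfolding new_generators_def by (simp only: cmp) simp
    qed
    moreover have "d < N \<longleftrightarrow> t = 0" "d = 0 \<longleftrightarrow> t = 0" using assms unfolding t by auto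
    moreover have "d = (2 * m + 1) * N \<longleftrightarrow> t = 2 * m + 1" unfolding t by (rule cmp)
    moreover have "\<not> (m * N < d \<and> d < m * N + N)"
      using cmp(2)[of m t] cmp(2)[of t "Suc m"] unfolding t by auto
    ultimately show ?thesis by auto
  next
    case False
    then have "d \<noteq> 0" "d \<noteq> m * N" "d \<noteq> (2 * m + 1) * N"
      by (metis dvd_0_right) (use False in auto)
    moreover have "?G d = (if m * N \<le> d then 2 else 0)"
      using False by (simp add: new_generators_def)
    moreover have "?G (d - N) = (if m * N + N \<le> d then 2 else 0)" if "N \<le> d"
    proof -
      have "\<not> N dvd d - N" using False that by (simp add: dvd_minus_self)
      then show ?thesis using that by (auto simp: new_generators_def)
    qed
    ultimately show ?thesis by auto
  qed
  moreover have "(Abs_fps ?G * (1 - fps_X ^ N)) $ d = ?G d - (if d < N then 0 else ?G (d - N))"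
    by (simp add: right_diff_distrib fps_X_power_mult_right_nth)
  moreover have "(1 + (\<Sum>j=1..N-1. 2 * fps_X ^ (m * N + j)) + fps_X ^ ((2 * m + 1) * N) :: rat fps) $ d =
      (if d = 0 then 1 else 0) + (if m * N < d \<and> d < m * N + N then 2 else 0) +
      (if d = (2 * m + 1) * N then 1 else 0)"
    unfolding fps_add_nth mid fps_X_power_nth fps_one_nth ..
  ultimately show "(Abs_fps ?G * (1 - fps_X ^ N)) $ d =
      (1 + (\<Sum>j=1..N-1. 2 * fps_X ^ (m * N + j)) + fps_X ^ ((2 * m + 1) * N)) $ d"
    by (simp only:)
qed

theorem mainTheorem8:
  fixes N m :: nat
  assumes "N \<ge> 2"
  shows "poincare_series (quasiinvariants N m) =
    (1 + (\<Sum>j=1..N-1. 2 * fps_X ^ (m * N + j)) + fps_X ^ ((2 * m + 1) * N)) /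
    ((1 - fps_X ^ 2) * (1 - fps_X ^ N))"
proof -
  have N: "N > 0" using assms by simp
  let ?P = "poincare_series (quasiinvariants N m)"
  let ?D = "(1 - fps_X ^ 2) * (1 - fps_X ^ N) :: rat fps"
  \<comment> \<open>Constant term 1 makes both factors of the denominator nonzero, so the quotient
    follows from the product identity.\<close>
  have "(1 - fps_X ^ n :: rat fps) $ 0 = 1" if "n > 0" for n
    using that by simp
  then have "(1 - fps_X ^ n :: rat fps) \<noteq> 0" if "n > 0" for n
    using that by (metis fps_zero_nth zero_neq_one)
  then have "?D \<noteq> 0" using N by simp
  moreover have "?P * ?D =
      1 + (\<Sum>j=1..N-1. 2 * fps_X ^ (m * N + j)) + fps_X ^ ((2 * m + 1) * N)"
    unfolding poincare_series_quasiinvariants[OF N] mult.assoc[symmetric]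
      quasi_dim_fps new_generators_fps[OF N] ..
  ultimately show ?thesis by (metis nonzero_mult_div_cancel_right)
qed

end
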